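(* For $\kappa=-1,0,$ or $1$, let $\gamma:(-\infty,\infty)\to M$ be a unit speed geodesic in a complete Riemannian $n$-manifold $M$ with $\mathrm{sec}(\dot\gamma,\cdot)\geq\kappa$. Let $J_0$ be a nonzero, normal Jacobi field along $\gamma$, and let $\Lambda$ be a Lagrangian subspace of normal Jacobi fields along $\gamma$ with Riccati operator $S$ such that $J_0\in\Lambda$. For $t_0<t_{\max}$, suppose that $J_0(t_0)\neq 0$, that $\Lambda$ has no singularities on $(t_0,t_{\max})$, and that $\tilde\lambda_\kappa:[t_0,t_{\max})\to\mathbb{R}$ is a solution of $$\tilde\lambda_\kappa'+\tilde\lambda_\kappa^2+\kappa=0$$ with $$\langle S(J_0),J_0\rangle|_{t_0}\leq\tilde\lambda_\kappa(t_0)\,|J_0(t_0)|^2 .\qquad ( * )$$ Then for each $t_1\in[t_0,t_{\max})$ there is a $J_1\in\Lambda\setminus\{0\}$ so that $$\langle S(J_1),J_1\rangle|_{t_1}\leq\tilde\lambda_\kappa(t_1)\,|J_1(t_1)|^2 .$$ In particular, if $\kappa=1$, $\alpha\in[0,\pi)$, $\tilde\lambda_1(t)=\cot(t+\alpha)$, $t_0\in[0,\pi-\alpha)$ (with $\tilde\lambda_1$ defined at $t_0$, i.e. $t_0+\alpha>0$), $J_0(t_0)\ne 0$ and $( * )$ holds, then $\Lambda$ has a singularity by time $\pi-\alpha$; that is, there is a $J\in\Lambda\setminus\{0\}$ with $J(t_2)=0$ for some $t_2\in(t_0,\pi-\alpha]$.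
   Context: An $(n-1)$-dimensional subspace $\Lambda$ of the space of normal Jacobi fields along $\gamma$ is Lagrangian if $\langle J_1(t),J_2'(t)\rangle=\langle J_1'(t),J_2(t)\rangle$ for all $t$ and all $J_1,J_2\in\Lambda$. A singularity of $\Lambda$ is a time $t$ at which some nonzero $J\in\Lambda$ satisfies $J(t)=0$. The Riccati operator $S$ of $\Lambda$ sends $J(t)$ to $J'(t)$ for $J\in\Lambda$, so $\langle S(J),J\rangle|_t=\langle J'(t),J(t)\rangle$; on the span of a single $J\in \Lambda$ it is well defined at $t$ when $J(t)\neq0$. The hypothesis $\mathrm{sec}(\dot\gamma,\cdot)\geq\kappa$ means that every plane containing $\dot\gamma(t)$, for any $t$, has sectional curvature $\geq\kappa$. *)

theory Defs
  imports "HOL-Analysis.Analysis" "HOL-Library.Function_Algebras"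
begin

instantiation "fun" :: (type, real_vector) real_vector
begin

definition scaleR_fun_def: "a *\<^sub>R f = (\<lambda>x. a *\<^sub>R f x)"

instance
  by standard (simp_all add: scaleR_fun_def fun_eq_iff scaleR_add_right scaleR_add_left)

end

lemma scaleR_fun_apply [simp]: "(a *\<^sub>R f) x = a *\<^sub>R f x"
  by (simp add: scaleR_fun_def)

(* The next two predicates are meant for open S only. *)

primrec Ck_on :: "nat \<Rightarrow> 'a::real_normed_vector set \<Rightarrow> ('a \<Rightarrow> 'b::real_normed_vector) \<Rightarrow> bool" where
  "Ck_on 0 S f \<longleftrightarrow> continuous_on S f"
| "Ck_on (Suc k) S f \<longleftrightarrow>
     f differentiable_on S \<and> (\<forall>v. Ck_on k S (\<lambda>x. frechet_derivative f (at x) v))"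

definition smooth_on :: "'a::real_normed_vector set \<Rightarrow> ('a \<Rightarrow> 'b::real_normed_vector) \<Rightarrow> bool" where
  "smooth_on S f \<longleftrightarrow> (\<forall>k. Ck_on k S f)"


(* A chart is a pair (U, \<phi>); only the values of \<phi> on U matter. *)
type_synonym ('m, 'n) chart = "'m set \<times> ('m \<Rightarrow> real ^ 'n)"

definition chart_at :: "('m, 'n) chart set \<Rightarrow> 'm \<Rightarrow> ('m, 'n) chart \<Rightarrow> bool" where
  "chart_at A p c \<longleftrightarrow> c \<in> A \<and> p \<in> fst c"

definition transition :: "('m, 'n) chart \<Rightarrow> ('m, 'n) chart \<Rightarrow> real ^ 'n \<Rightarrow> real ^ 'n" where
  "transition c d = snd d \<circ> inv_into (fst c) (snd c)"

(* The manifold is the whole type 'm, of dimension CARD('n). The atlas is not required to be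
   maximal: any smooth atlas determines the smooth structure. *)
definition smooth_atlas ::
  "('m::{t2_space,second_countable_topology}, 'n::finite) chart set \<Rightarrow> bool" where
  "smooth_atlas A \<longleftrightarrow>
     (\<Union>c\<in>A. fst c) = UNIV \<and>
     (\<forall>(U, \<phi>)\<in>A. open U \<and> open (\<phi> ` U) \<and> homeomorphism U (\<phi> ` U) \<phi> (inv_into U \<phi>)) \<and>
     (\<forall>c\<in>A. \<forall>d\<in>A. smooth_on (snd c ` (fst c \<inter> fst d)) (transition c d))"

(* A tangent vector is the family of its component vectors in all charts around its base point,
   related by the differentials of the transition maps; it is set to 0 at all other charts, so
   that equality of tangent vectors is equality of functions. *)
type_synonym ('m, 'n) tvec = "('m, 'n) chart \<Rightarrow> real ^ 'n"

definition tangent_space :: "('m, 'n::finite) chart set \<Rightarrow> 'm \<Rightarrow> ('m, 'n) tvec set" where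
  "tangent_space A p = {v.
     (\<forall>c d. chart_at A p c \<and> chart_at A p d \<longrightarrow>
        v d = frechet_derivative (transition c d) (at (snd c p)) (v c)) \<and>
     (\<forall>c. \<not> chart_at A p c \<longrightarrow> v c = 0)}"

(* The metric tensor: its Gram matrix in each chart, as a function of the coordinates. *)
type_synonym ('m, 'n) mtensor = "('m, 'n) chart \<Rightarrow> real ^ 'n \<Rightarrow> real ^ 'n ^ 'n"

definition riemannian_manifold ::
  "('m::{t2_space,second_countable_topology}, 'n::finite) chart set \<Rightarrow> ('m, 'n) mtensor \<Rightarrow> bool" where
  "riemannian_manifold A g \<longleftrightarrow>
     smooth_atlas A \<and>
     (\<forall>c\<in>A. smooth_on (snd c ` fst c) (g c) \<and>
        (\<forall>x\<in>snd c ` fst c. transpose (g c x) = g c x \<and> (\<forall>v. v \<noteq> 0 \<longrightarrow> v \<bullet> (g c x *v v) > 0))) \<and>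
     (\<forall>p c d. chart_at A p c \<and> chart_at A p d \<longrightarrow>
        (let D = frechet_derivative (transition c d) (at (snd c p)) in
         \<forall>v w. v \<bullet> (g c (snd c p) *v w) = D v \<bullet> (g d (snd d p) *v D w)))"

definition rinner ::
  "('m, 'n::finite) chart set \<Rightarrow> ('m, 'n) mtensor \<Rightarrow> 'm \<Rightarrow> ('m, 'n) tvec \<Rightarrow> ('m, 'n) tvec \<Rightarrow> real" where
  "rinner A g p v w = (let c = (SOME c. chart_at A p c) in v c \<bullet> (g c (snd c p) *v w c))"

lemma rinner_eq:
  assumes "riemannian_manifold A g" "v \<in> tangent_space A p" "w \<in> tangent_space A p" "chart_at A p c"
  shows "rinner A g p v w = v c \<bullet> (g c (snd c p) *v w c)"
proof -
  define d where "d = (SOME c. chart_at A p c)"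
  have d: "chart_at A p d"
    unfolding d_def using assms(4) by (rule someI)
  have "v c = frechet_derivative (transition d c) (at (snd d p)) (v d)"
       "w c = frechet_derivative (transition d c) (at (snd d p)) (w d)"
    using assms d unfolding tangent_space_def by blast+
  moreover have "rinner A g p v w = v d \<bullet> (g d (snd d p) *v w d)"
    by (simp add: rinner_def Let_def d_def)
  ultimately show ?thesis
    using assms d unfolding riemannian_manifold_def Let_def by metis
qed

definition rnorm ::
  "('m, 'n::finite) chart set \<Rightarrow> ('m, 'n) mtensor \<Rightarrow> 'm \<Rightarrow> ('m, 'n) tvec \<Rightarrow> real" where
  "rnorm A g p v = sqrt (rinner A g p v v)"

definition partial :: "'n::finite \<Rightarrow> (real ^ 'n \<Rightarrow> real) \<Rightarrow> real ^ 'n \<Rightarrow> real" where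
  "partial i f x = frechet_derivative f (at x) (axis i 1)"

(* christoffel g c x k i j is the symbol with upper index k and lower indices i, j. *)
definition christoffel ::
  "('m, 'n::finite) mtensor \<Rightarrow> ('m, 'n) chart \<Rightarrow> real ^ 'n \<Rightarrow> 'n \<Rightarrow> 'n \<Rightarrow> 'n \<Rightarrow> real" where
  "christoffel g c x k i j =
     (\<Sum>l\<in>UNIV. matrix_inv (g c x) $ k $ l *
        (partial i (\<lambda>y. g c y $ j $ l) x + partial j (\<lambda>y. g c y $ i $ l) x
         - partial l (\<lambda>y. g c y $ i $ j) x)) / 2"

(* Components of the curvature tensor of the Levi-Civita connection, with
   R(X,Y)Z = D_X D_Y Z - D_Y D_X Z - D_[X,Y] Z and
   R(e_i, e_j) e_k = sum over l of (curvature_coeff g c x l i j k) e_l. *)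
definition curvature_coeff ::
  "('m, 'n::finite) mtensor \<Rightarrow> ('m, 'n) chart \<Rightarrow> real ^ 'n \<Rightarrow> 'n \<Rightarrow> 'n \<Rightarrow> 'n \<Rightarrow> 'n \<Rightarrow> real" where
  "curvature_coeff g c x l i j k =
     partial i (\<lambda>y. christoffel g c y l j k) x - partial j (\<lambda>y. christoffel g c y l i k) x
     + (\<Sum>m\<in>UNIV. christoffel g c x l i m * christoffel g c x m j k
                - christoffel g c x l j m * christoffel g c x m i k)"

definition curvature ::
  "('m, 'n::finite) chart set \<Rightarrow> ('m, 'n) mtensor \<Rightarrow> 'm \<Rightarrow>
     ('m, 'n) tvec \<Rightarrow> ('m, 'n) tvec \<Rightarrow> ('m, 'n) tvec \<Rightarrow> ('m, 'n) tvec" where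
  "curvature A g p X Y Z = (\<lambda>c. if chart_at A p c then
     (\<chi> l. \<Sum>i\<in>UNIV. \<Sum>j\<in>UNIV. \<Sum>k\<in>UNIV.
        curvature_coeff g c (snd c p) l i j k * (X c $ i) * (Y c $ j) * (Z c $ k)) else 0)"

(* Sectional curvature of the plane spanned by linearly independent v, w. *)
definition sectional_curvature ::
  "('m, 'n::finite) chart set \<Rightarrow> ('m, 'n) mtensor \<Rightarrow> 'm \<Rightarrow> ('m, 'n) tvec \<Rightarrow> ('m, 'n) tvec \<Rightarrow> real" where
  "sectional_curvature A g p v w =
     rinner A g p (curvature A g p v w w) v /
     (rinner A g p v v * rinner A g p w w - (rinner A g p v w)\<^sup>2)"

definition smooth_curve ::
  "('m::topological_space, 'n::finite) chart set \<Rightarrow> (real \<Rightarrow> 'm) \<Rightarrow> bool" where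
  "smooth_curve A \<gamma> \<longleftrightarrow> continuous_on UNIV \<gamma> \<and>
     (\<forall>c\<in>A. smooth_on {t. \<gamma> t \<in> fst c} (\<lambda>t. snd c (\<gamma> t)))"

definition velocity ::
  "('m, 'n::finite) chart set \<Rightarrow> (real \<Rightarrow> 'm) \<Rightarrow> real \<Rightarrow> ('m, 'n) tvec" where
  "velocity A \<gamma> t = (\<lambda>c. if chart_at A (\<gamma> t) c
     then vector_derivative (\<lambda>s. snd c (\<gamma> s)) (at t) else 0)"

definition smooth_field_along ::
  "('m, 'n::finite) chart set \<Rightarrow> (real \<Rightarrow> 'm) \<Rightarrow> (real \<Rightarrow> ('m, 'n) tvec) \<Rightarrow> bool" where
  "smooth_field_along A \<gamma> V \<longleftrightarrow> (\<forall>t. V t \<in> tangent_space A (\<gamma> t)) \<and>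
     (\<forall>c\<in>A. smooth_on {t. \<gamma> t \<in> fst c} (\<lambda>t. V t c))"

definition cov_deriv ::
  "('m, 'n::finite) chart set \<Rightarrow> ('m, 'n) mtensor \<Rightarrow> (real \<Rightarrow> 'm) \<Rightarrow>
     (real \<Rightarrow> ('m, 'n) tvec) \<Rightarrow> real \<Rightarrow> ('m, 'n) tvec" where
  "cov_deriv A g \<gamma> V t = (\<lambda>c. if chart_at A (\<gamma> t) c
     then vector_derivative (\<lambda>s. V s c) (at t) +
       (\<chi> k. \<Sum>i\<in>UNIV. \<Sum>j\<in>UNIV.
          christoffel g c (snd c (\<gamma> t)) k i j * (velocity A \<gamma> t c $ i) * (V t c $ j))
     else 0)"

definition geodesic ::
  "('m::topological_space, 'n::finite) chart set \<Rightarrow> ('m, 'n) mtensor \<Rightarrow> (real \<Rightarrow> 'm) \<Rightarrow> bool" where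
  "geodesic A g \<gamma> \<longleftrightarrow> smooth_curve A \<gamma> \<and> (\<forall>t. cov_deriv A g \<gamma> (velocity A \<gamma>) t = 0)"

definition unit_speed ::
  "('m, 'n::finite) chart set \<Rightarrow> ('m, 'n) mtensor \<Rightarrow> (real \<Rightarrow> 'm) \<Rightarrow> bool" where
  "unit_speed A g \<gamma> \<longleftrightarrow> (\<forall>t. rnorm A g (\<gamma> t) (velocity A \<gamma> t) = 1)"

(* Completeness in the sense that the exponential map is defined on all of TM. *)
definition complete_riemannian_manifold ::
  "('m::{t2_space,second_countable_topology}, 'n::finite) chart set \<Rightarrow> ('m, 'n) mtensor \<Rightarrow> bool" where
  "complete_riemannian_manifold A g \<longleftrightarrow> riemannian_manifold A g \<and>
     (\<forall>p. \<forall>v\<in>tangent_space A p. \<exists>\<gamma>. geodesic A g \<gamma> \<and> \<gamma> 0 = p \<and> velocity A \<gamma> 0 = v)"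

definition sec_along_ge ::
  "('m, 'n::finite) chart set \<Rightarrow> ('m, 'n) mtensor \<Rightarrow> (real \<Rightarrow> 'm) \<Rightarrow> real \<Rightarrow> bool" where
  "sec_along_ge A g \<gamma> \<kappa> \<longleftrightarrow>
     (\<forall>t. \<forall>w\<in>tangent_space A (\<gamma> t). velocity A \<gamma> t \<noteq> w \<and> independent {velocity A \<gamma> t, w} \<longrightarrow>
        sectional_curvature A g (\<gamma> t) (velocity A \<gamma> t) w \<ge> \<kappa>)"

definition jacobi_field ::
  "('m, 'n::finite) chart set \<Rightarrow> ('m, 'n) mtensor \<Rightarrow> (real \<Rightarrow> 'm) \<Rightarrow> (real \<Rightarrow> ('m, 'n) tvec) \<Rightarrow> bool" where
  "jacobi_field A g \<gamma> J \<longleftrightarrow> smooth_field_along A \<gamma> J \<and>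
     (\<forall>t. cov_deriv A g \<gamma> (cov_deriv A g \<gamma> J) t
          + curvature A g (\<gamma> t) (J t) (velocity A \<gamma> t) (velocity A \<gamma> t) = 0)"

definition normal_jacobi_fields ::
  "('m, 'n::finite) chart set \<Rightarrow> ('m, 'n) mtensor \<Rightarrow> (real \<Rightarrow> 'm) \<Rightarrow> (real \<Rightarrow> ('m, 'n) tvec) set" where
  "normal_jacobi_fields A g \<gamma> =
     {J. jacobi_field A g \<gamma> J \<and> (\<forall>t. rinner A g (\<gamma> t) (J t) (velocity A \<gamma> t) = 0)}"

definition lagrangian ::
  "('m, 'n::finite) chart set \<Rightarrow> ('m, 'n) mtensor \<Rightarrow> (real \<Rightarrow> 'm) \<Rightarrow> (real \<Rightarrow> ('m, 'n) tvec) set \<Rightarrow> bool" where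
  "lagrangian A g \<gamma> \<Lambda> \<longleftrightarrow>
     subspace \<Lambda> \<and> \<Lambda> \<subseteq> normal_jacobi_fields A g \<gamma> \<and> dim \<Lambda> = CARD('n) - 1 \<and>
     (\<forall>J\<^sub>1\<in>\<Lambda>. \<forall>J\<^sub>2\<in>\<Lambda>. \<forall>t.
        rinner A g (\<gamma> t) (J\<^sub>1 t) (cov_deriv A g \<gamma> J\<^sub>2 t) =
        rinner A g (\<gamma> t) (cov_deriv A g \<gamma> J\<^sub>1 t) (J\<^sub>2 t))"

definition singularity :: "(real \<Rightarrow> ('m, 'n::finite) tvec) set \<Rightarrow> real \<Rightarrow> bool" where
  "singularity \<Lambda> t \<longleftrightarrow> (\<exists>J\<in>\<Lambda> - {0}. J t = 0)"

(* S sends J(t) to J'(t) for J in \<Lambda>. At a singular time J'(t) depends on J and not only on J(t),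
   so S takes the field J itself as its argument. *)
definition riccati_operator ::
  "('m, 'n::finite) chart set \<Rightarrow> ('m, 'n) mtensor \<Rightarrow> (real \<Rightarrow> 'm) \<Rightarrow> (real \<Rightarrow> ('m, 'n) tvec) set \<Rightarrow>
     (real \<Rightarrow> ('m, 'n) tvec) \<Rightarrow> real \<Rightarrow> ('m, 'n) tvec" where
  "riccati_operator A g \<gamma> \<Lambda> = (\<lambda>J\<in>\<Lambda>. cov_deriv A g \<gamma> J)"

end

theory Submission
  imports Defs
begin

text \<open>
  Write \<open>l\<close> for the solution of the scalar Riccati equation and, for a time at which
  \<open>\<Lambda>\<close> is not singular, let \<open>\<mu>(t)\<close> be the least value of the
  Rayleigh quotient \<open>\<langle>J', J\<rangle> / |J|\<^sup>2\<close> over \<open>J \<in> \<Lambda> - {0}\<close>, that is, the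
  smallest eigenvalue of the Riccati operator \<open>S\<close>. The first claim says that
  \<open>\<mu>(t\<^sub>1) \<le> l(t\<^sub>1)\<close>. The Riccati operator satisfies \<open>S' + S\<^sup>2 + R = 0\<close> with \<open>R \<ge> \<kappa>\<close>, so at an
  eigenvector for \<open>\<mu>\<close> the quotient has derivative at most \<open>-\<mu>\<^sup>2 - \<kappa>\<close>. Hence
  \<open>(\<mu> - l)' \<le> -(\<mu> + l)(\<mu> - l)\<close>, and with \<open>w' = 2 l w\<close>, \<open>w > 0\<close>,
  \<open>(w (\<mu> - l))' \<le> - w (\<mu> - l)\<^sup>2 \<le> 0\<close>.
  So \<open>w (\<mu> - l)\<close> does not increase; near \<open>t\<^sub>0\<close> it is bounded by its value on the single field
  \<open>J\<^sub>0\<close>, whose limit at \<open>t\<^sub>0\<close> is nonpositive by hypothesis. Working with \<open>J\<^sub>0\<close> there rather than with \<open>\<mu>\<close>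
  allows \<open>\<Lambda>\<close> to be singular at \<open>t\<^sub>0\<close> itself.

  The function \<open>\<mu>\<close> need not be differentiable. The lemma \<open>min_over_compact_nonincreasing\<close> replaces
  the differential inequality: a minimum over a compact set does not increase as soon as, at each
  time, every minimizer has nonpositive derivative. The lemma
  \<open>rayleigh_quotient_riccati_comparison\<close> applies this to two abstract families of bilinear forms.
  It involves no differential equation for vector fields, hence no parallel transport.

  What has to be known about \<open>\<Lambda>\<close> is collected in \<open>rayleigh_derivative\<close>: a field \<open>J\<close> that is critical
  for the quotient satisfies \<open>J' = r J\<close> at that time, because the values of a nonsingular
  Lagrangian family fill the normal space, and the curvature term in the derivative is bounded
  by \<open>\<kappa>\<close>. The Jacobi equation contains \<open>\<langle>R(J, v)v, J\<rangle>\<close>, whereas sectional curvature contains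
  \<open>\<langle>R(v, J)J, v\<rangle>\<close>; their equality (\<open>curvature_inner_swap\<close>) comes from differentiating the
  compatibility of metric and connection once more, which uses the symmetry of second derivatives.

  The covariant derivative is defined chart by chart, and its transformation law is avoided
  throughout. The quantity \<open>\<langle>J, K\<rangle>\<close> does not depend on the chart, and
  \<open>\<langle>J, K\<rangle>' = 2 \<langle>J', K\<rangle>\<close> for \<open>J, K \<in> \<Lambda>\<close>, so \<open>\<langle>J', K\<rangle>\<close> does not depend on it either; every derivative
  at a time \<open>t\<close> can therefore be computed in the one chart that defines the inner product at \<open>t\<close>.

  For the second claim, suppose that there were no singularity up to and including \<open>\<pi> - \<alpha>\<close>. By compactness
  the quotients would be bounded below near \<open>\<pi> - \<alpha>\<close>, but by the first claim their minimum lies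
  below \<open>cot (t + \<alpha>)\<close>, which tends to \<open>-\<infinity>\<close>.
\<close>

section \<open>Comparison for the smallest Rayleigh quotient\<close>

text \<open>
  First variation: \<open>B (x + r y) (x + r y) = 2 r B x y + r\<^sup>2 B y y\<close> is nonnegative for all \<open>r\<close>, which
  forces the linear term to vanish.
\<close>

lemma psd_form_null_vector:
  fixes B :: "'v::real_vector \<Rightarrow> 'v \<Rightarrow> real"
  assumes B: "bilinear B" and sym: "\<And>x y. B x y = B y x"
    and E: "subspace E" and psd: "\<And>z. z \<in> E \<Longrightarrow> 0 \<le> B z z"
    and x: "x \<in> E" "B x x = 0" and y: "y \<in> E"
  shows "B x y = 0"
proof (rule ccontr)
  assume b: "B x y \<noteq> 0"
  define c where "c = B y y"
  \<comment> \<open>The minimizer of the quadratic polynomial is \<open>- B x y / c\<close>; the summand \<open>1\<close> covers \<open>c = 0\<close>.\<close>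
  define r where "r = - B x y / (c + 1)"
  have c: "c \<ge> 0" using psd y c_def by simp
  have "x + r *\<^sub>R y \<in> E" using E x y by (simp add: subspace_add subspace_scale)
  then have "0 \<le> B (x + r *\<^sub>R y) (x + r *\<^sub>R y)" by (rule psd)
  also have "\<dots> = r * (2 * B x y + r * c)"
    using x(2) sym[of y x]
    by (simp add: bilinear_ladd[OF B] bilinear_radd[OF B] bilinear_lmul[OF B] bilinear_rmul[OF B]
        c_def algebra_simps)
  also have "\<dots> = - (B x y)\<^sup>2 / (c + 1) * ((c + 2) / (c + 1))"
    using c by (simp add: r_def field_simps power2_eq_square)
  also have "\<dots> < 0"
    using b c by (intro mult_neg_pos) (auto simp: divide_simps)
  finally show False by simp
qed

text \<open>
  Expansion in a basis reduces joint continuity in time and vector to continuity in time of finitely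
  many coefficients.
\<close>

lemma bilinear_diagonal_continuous:
  fixes P :: "'t::topological_space \<Rightarrow> 'v::euclidean_space \<Rightarrow> 'v \<Rightarrow> real"
  assumes bil: "\<And>t. bilinear (P t)"
    and cont: "\<And>x y. continuous_on I (\<lambda>t. P t x y)"
  shows "continuous_on (I \<times> K) (\<lambda>z. P (fst z) (snd z) (snd z))"
proof -
  have "P t x x = (\<Sum>i\<in>Basis. \<Sum>j\<in>Basis. (x \<bullet> i) * (x \<bullet> j) * P t i j)" for t x
  proof -
    have "P t x x = P t (\<Sum>i\<in>Basis. (x \<bullet> i) *\<^sub>R i) (\<Sum>j\<in>Basis. (x \<bullet> j) *\<^sub>R j)"
      by (simp add: euclidean_representation)
    also have "\<dots> = (\<Sum>(i, j)\<in>Basis \<times> Basis. P t ((x \<bullet> i) *\<^sub>R i) ((x \<bullet> j) *\<^sub>R j))"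
      by (rule bilinear_sum[OF bil])
    finally show ?thesis
      by (simp add: sum.cartesian_product bilinear_lmul[OF bil] bilinear_rmul[OF bil] ac_simps)
  qed
  moreover have "continuous_on (I \<times> K) (\<lambda>z. P (fst z) i j)" for i j
    by (rule continuous_on_compose2[OF cont[of i j]]) (auto intro!: continuous_intros)
  ultimately show ?thesis
    by (auto intro!: continuous_intros)
qed

text \<open>
  The minimum of \<open>h t\<close> over \<open>K\<close> is compared with the line of slope \<open>e > 0\<close> through
  \<open>(a, h a x0)\<close>. The times at which it lies below this line are the projection of a compact set, so
  there is a last one; before \<open>b\<close> that is impossible, since the minimizer at this time keeps
  \<open>h\<close> below the line a little longer.
\<close>

lemma min_over_compact_nonincreasing:
  fixes h :: "real \<Rightarrow> 'v::metric_space \<Rightarrow> real"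
  assumes ab: "a \<le> b" and K: "compact K" and x0: "x0 \<in> K"
    and cont: "continuous_on ({a..b} \<times> K) (\<lambda>z. h (fst z) (snd z))"
    and decr: "\<And>t x. t \<in> {a..<b} \<Longrightarrow> x \<in> K \<Longrightarrow> (\<And>y. y \<in> K \<Longrightarrow> h t x \<le> h t y) \<Longrightarrow>
      \<exists>d\<le>0. ((\<lambda>s. h s x) has_real_derivative d) (at t within {a..b})"
  shows "\<exists>x\<in>K. h b x \<le> h a x0"
proof -
  have slice: "continuous_on K (h t)" if "t \<in> {a..b}" for t
  proof -
    have "continuous_on K ((\<lambda>z. h (fst z) (snd z)) \<circ> (\<lambda>x. (t, x)))"
      using that by (intro continuous_on_compose continuous_intros continuous_on_subset[OF cont]) auto
    then show ?thesis by (simp add: o_def)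
  qed
  have minimizer: "\<exists>x\<in>K. \<forall>y\<in>K. h t x \<le> h t y" if "t \<in> {a..b}" for t
    using continuous_attains_inf[OF K _ slice[OF that]] x0 by blast
  have below: "\<exists>x\<in>K. h b x \<le> h a x0 + e * (b - a)" if e: "e > 0" for e
  proof -
    define C where "C = {z \<in> {a..b} \<times> K. h (fst z) (snd z) - e * (fst z - a) \<le> h a x0}"
    have "closed C"
    proof -
      have "closed ({a..b} \<times> K)" using K by (simp add: closed_Times compact_imp_closed)
      then show ?thesis unfolding C_def
        by (intro continuous_on_closed_Collect_le continuous_intros cont)
    qed
    then have "compact (({a..b} \<times> K) \<inter> C)"
      using K by (intro compact_Int_closed compact_Times) auto
    moreover have "({a..b} \<times> K) \<inter> C = C" unfolding C_def by auto
    ultimately have comp: "compact (fst ` C)"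
      by (intro compact_continuous_image continuous_intros) simp
    have a: "a \<in> fst ` C"
      using ab x0 by (intro image_eqI[of _ _ "(a, x0)"]) (simp_all add: C_def)
    then obtain t where t: "t \<in> fst ` C" "\<And>s. s \<in> fst ` C \<Longrightarrow> s \<le> t"
      using compact_attains_sup[OF comp] by blast
    then obtain x where x: "t \<in> {a..b}" "x \<in> K" "h t x \<le> h a x0 + e * (t - a)"
      by (auto simp: C_def)
    have "t = b"
    proof (rule ccontr)
      assume "t \<noteq> b"
      then have tb: "t \<in> {a..<b}" using x by auto
      obtain m where m: "m \<in> K" "\<And>y. y \<in> K \<Longrightarrow> h t m \<le> h t y"
        using minimizer[OF x(1)] by blast
      obtain d where d: "d \<le> 0" "((\<lambda>s. h s m) has_real_derivative d) (at t within {a..b})"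
        using decr[OF tb m] by blast
      have "((\<lambda>s. h s m - e * (s - a)) has_real_derivative d - e) (at t within {a..b})"
        by (auto intro!: derivative_eq_intros d(2))
      then have "\<exists>\<delta>>0. \<forall>r>0. t + r \<in> {a..b} \<longrightarrow> r < \<delta> \<longrightarrow>
          h (t + r) m - e * (t + r - a) < h t m - e * (t - a)"
        by (rule has_real_derivative_neg_dec_right) (use d e in simp)
      then obtain \<delta> where \<delta>: "\<delta> > 0"
        "\<And>r. r > 0 \<Longrightarrow> t + r \<in> {a..b} \<Longrightarrow> r < \<delta> \<Longrightarrow> h (t + r) m - e * (t + r - a) < h t m - e * (t - a)"
        by blast
      define r where "r = min (\<delta> / 2) (b - t)"
      have r: "r > 0" "r < \<delta>" "t + r \<in> {a..b}" using \<delta>(1) tb by (auto simp: r_def)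
      have "h (t + r) m - e * (t + r - a) < h t m - e * (t - a)" using \<delta>(2)[of r] r by blast
      also have "\<dots> \<le> h t x - e * (t - a)" using m(2)[OF x(2)] by simp
      also have "\<dots> \<le> h a x0" using x(3) by simp
      finally have "t + r \<in> fst ` C"
        using r m by (intro image_eqI[of _ _ "(t + r, m)"]) (simp_all add: C_def)
      then show False using t(2) r(1) by fastforce
    qed
    then show ?thesis using x by auto
  qed
  obtain m where m: "m \<in> K" "\<And>y. y \<in> K \<Longrightarrow> h b m \<le> h b y"
    using minimizer[of b] ab by auto
  have "h b m \<le> h a x0 + e" if "e > 0" for e
  proof -
    have "e / (b - a + 1) > 0" using that ab by (simp add: divide_simps)
    from below[OF this] obtain x where x: "x \<in> K" "h b x \<le> h a x0 + e / (b - a + 1) * (b - a)" by blast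
    moreover have "e / (b - a + 1) * (b - a) \<le> e"
      using that ab by (simp add: divide_simps)
    ultimately show ?thesis using m(2)[OF x(1)] by linarith
  qed
  then have "h b m \<le> h a x0" by (rule field_le_epsilon)
  then show ?thesis using m(1) by blast
qed

text \<open>
  Here \<open>P t x x\<close> stands for \<open>|J|\<^sup>2\<close>, \<open>N t x x\<close> for \<open>\<langle>J', J\<rangle>\<close>, and \<open>x\<close> for the coordinates of \<open>J\<close>. The
  weight \<open>w\<close> with \<open>w' = 2 l w\<close> makes \<open>w (N/P - l)\<close> have derivative at most \<open>- w (r - l)\<^sup>2\<close> at a
  minimizer, where \<open>r\<close> is the value of \<open>N/P\<close>. Degeneration of \<open>P\<close> at \<open>a\<close> is allowed: the monotonicity is
  used on \<open>{a'..b}\<close>, and only the quotient of the fixed vector \<open>x0\<close> is followed as \<open>a'\<close> tends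
  to \<open>a\<close>.
\<close>

lemma rayleigh_quotient_riccati_comparison:
  fixes N P :: "real \<Rightarrow> 'v::euclidean_space \<Rightarrow> 'v \<Rightarrow> real" and l :: "real \<Rightarrow> real"
  assumes ab: "a < b" and E: "subspace E"
    and bil: "\<And>t. bilinear (N t)" "\<And>t. bilinear (P t)"
    and sym: "\<And>t x y. N t x y = N t y x" "\<And>t x y. P t x y = P t y x"
    and cont: "\<And>x y. continuous_on {a..b} (\<lambda>t. N t x y)" "\<And>x y. continuous_on {a..b} (\<lambda>t. P t x y)"
    and pos: "\<And>t x. t \<in> {a<..b} \<Longrightarrow> x \<in> E \<Longrightarrow> x \<noteq> 0 \<Longrightarrow> P t x x > 0"
    and critical: "\<And>t x r. t \<in> {a<..<b} \<Longrightarrow> x \<in> E \<Longrightarrow> x \<noteq> 0 \<Longrightarrow>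
      (\<And>y. y \<in> E \<Longrightarrow> N t x y = r * P t x y) \<Longrightarrow>
      \<exists>d\<le>-r\<^sup>2 - \<kappa>. ((\<lambda>s. N s x x / P s x x) has_real_derivative d) (at t)"
    and l: "\<And>t. t \<in> {a..b} \<Longrightarrow> (l has_real_derivative - (l t)\<^sup>2 - \<kappa>) (at t within {a..b})"
    and x0: "x0 \<in> E" "P a x0 x0 > 0" "N a x0 x0 \<le> l a * P a x0 x0"
  shows "\<exists>x\<in>E - {0}. N b x x \<le> l b * P b x x"
proof -
  have x0n: "x0 \<noteq> 0" using x0(2) bilinear_lzero[OF bil(2)] by auto
  have lcont: "continuous_on {a..b} l"
    by (rule DERIV_continuous_on) (rule l)
  define w where "w t = exp (2 * integral {a..t} l)" for t
  have wpos: "w t > 0" for t by (simp add: w_def)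
  have w: "(w has_real_derivative 2 * l t * w t) (at t within {a..b})" if "t \<in> {a..b}" for t
  proof -
    have "((\<lambda>t. exp (2 * integral {a..t} l)) has_real_derivative
        exp (2 * integral {a..t} l) * (2 * l t)) (at t within {a..b})"
      by (rule DERIV_chain2[OF DERIV_exp DERIV_cmult[OF integral_has_real_derivative[OF lcont that]]])
    then show ?thesis by (simp add: w_def[abs_def] ac_simps)
  qed
  have wcont: "continuous_on {a..b} w"
    by (rule DERIV_continuous_on) (rule w)
  define K where "K = sphere 0 1 \<inter> E"
  have K: "compact K" unfolding K_def
    using E by (intro compact_Int_closed) (auto intro: closed_subspace)
  have KE: "x \<in> E" "x \<noteq> 0" if "x \<in> K" for x using that by (auto simp: K_def)
  define h where "h t x = w t * (N t x x / P t x x - l t)" for t x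
  have homog: "N t (r *\<^sub>R x) (r *\<^sub>R x) / P t (r *\<^sub>R x) (r *\<^sub>R x) = N t x x / P t x x"
    if "r \<noteq> 0" for t r x
    using that by (simp add: bilinear_lmul[OF bil(1)] bilinear_rmul[OF bil(1)]
        bilinear_lmul[OF bil(2)] bilinear_rmul[OF bil(2)])
  define u where "u = x0 /\<^sub>R norm x0"
  have u: "u \<in> K" using x0n x0(1) E by (simp add: u_def K_def subspace_scale)
  have hu: "h t u = w t * (N t x0 x0 / P t x0 x0 - l t)" for t
    using homog[of "inverse (norm x0)" t x0] x0n by (simp add: h_def u_def)
  have step: "\<exists>x\<in>K. h b x \<le> h a' u" if a': "a' \<in> {a<..<b}" for a'
  proof (rule min_over_compact_nonincreasing)
    show "a' \<le> b" "compact K" "u \<in> K" using that K u by auto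
    have sub: "{a'..b} \<subseteq> {a..b}" using that by auto
    have "continuous_on ({a'..b} \<times> K) (\<lambda>z. N (fst z) (snd z) (snd z))"
      "continuous_on ({a'..b} \<times> K) (\<lambda>z. P (fst z) (snd z) (snd z))"
      by (intro bilinear_diagonal_continuous bil continuous_on_subset[OF cont(1) sub]
          continuous_on_subset[OF cont(2) sub])+
    moreover have "continuous_on ({a'..b} \<times> K) (\<lambda>z. l (fst z))" "continuous_on ({a'..b} \<times> K) (\<lambda>z. w (fst z))"
      using a' by (auto intro!: continuous_intros continuous_on_compose2[OF lcont]
          continuous_on_compose2[OF wcont])
    moreover have "P (fst z) (snd z) (snd z) \<noteq> 0" if "z \<in> {a'..b} \<times> K" for z
      using pos[of "fst z" "snd z"] KE[of "snd z"] that a' by auto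
    ultimately show "continuous_on ({a'..b} \<times> K) (\<lambda>z. h (fst z) (snd z))"
      unfolding h_def by (intro continuous_intros) auto
  next
    fix t x assume t: "t \<in> {a'..<b}" and x: "x \<in> K" and min: "\<And>y. y \<in> K \<Longrightarrow> h t x \<le> h t y"
    define r where "r = N t x x / P t x x"
    have t': "t \<in> {a<..<b}" "t \<in> {a..b}" "t \<in> {a<..b}" using t a' by auto
    note Pp = pos[OF t'(3)]
    have ge: "0 \<le> N t z z - r * P t z z" if "z \<in> E" for z
    proof (cases "z = 0")
      case True
      then show ?thesis by (simp add: bilinear_lzero[OF bil(1)] bilinear_lzero[OF bil(2)])
    next
      case False
      have "z /\<^sub>R norm z \<in> K" using False that E by (simp add: K_def subspace_scale)
      from min[OF this] have "r \<le> N t z z / P t z z"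
        using homog[of "inverse (norm z)" t z] False wpos[of t] by (simp add: h_def r_def)
      then show ?thesis using Pp[OF that False] by (simp add: pos_le_divide_eq)
    qed
    \<comment> \<open>The form \<open>N - r P\<close> is nonnegative on \<open>E\<close> and vanishes at the minimizer.\<close>
    have "N t x y - r * P t x y = 0" if "y \<in> E" for y
    proof (rule psd_form_null_vector[of "\<lambda>x y. N t x y - r * P t x y" E])
      show "bilinear (\<lambda>x y. N t x y - r * P t x y)"
        using bil unfolding bilinear_def
        by (auto intro!: linear_compose_sub linear_compose_scale_right[where 'b=real, simplified])
      show "N t x x - r * P t x x = 0" using Pp[OF KE[OF x]] by (simp add: r_def)
    qed (use sym E ge KE[OF x] that in auto)
    then obtain d where d: "d \<le> - r\<^sup>2 - \<kappa>" "((\<lambda>s. N s x x / P s x x) has_real_derivative d) (at t)"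
      using critical[OF t'(1) KE[OF x], of r] by auto
    have sub: "{a'..b} \<subseteq> {a..b}" using a' by auto
    have "((\<lambda>s. h s x) has_real_derivative
        2 * l t * w t * (r - l t) + w t * (d - (- (l t)\<^sup>2 - \<kappa>))) (at t within {a'..b})"
      unfolding h_def r_def
      by (rule derivative_eq_intros has_field_derivative_at_within[OF d(2)]
          DERIV_subset[OF w[OF t'(2)] sub] DERIV_subset[OF l[OF t'(2)] sub] refl)+
        (simp add: algebra_simps)
    moreover have "2 * l t * w t * (r - l t) + w t * (d - (- (l t)\<^sup>2 - \<kappa>)) \<le> 0"
    proof -
      have "2 * l t * (r - l t) + (d - (- (l t)\<^sup>2 - \<kappa>)) \<le> - (r - l t)\<^sup>2"
        using d(1) by (simp add: power2_eq_square algebra_simps)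
      also have "\<dots> \<le> 0" by simp
      finally have "w t * (2 * l t * (r - l t) + (d - (- (l t)\<^sup>2 - \<kappa>))) \<le> 0"
        using wpos[of t] by (simp add: mult_le_0_iff)
      then show ?thesis by (simp add: algebra_simps)
    qed
    ultimately show "\<exists>d\<le>0. ((\<lambda>s. h s x) has_real_derivative d) (at t within {a'..b})" by blast
  qed
  have bcont: "continuous_on K (h b)"
  proof -
    have "continuous_on K (\<lambda>x. N b x x)" "continuous_on K (\<lambda>x. P b x x)"
      using bil[of b] by (auto simp: bilinear_conv_bounded_bilinear
          intro: bounded_bilinear.continuous_on[OF _ continuous_on_id continuous_on_id])
    moreover have "P b x x \<noteq> 0" if "x \<in> K" for x
      using pos[OF _ KE[OF that], of b] ab by simp
    ultimately show ?thesis unfolding h_def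
      by (intro continuous_intros) auto
  qed
  obtain m where m: "m \<in> K" "\<And>y. y \<in> K \<Longrightarrow> h b m \<le> h b y"
    using continuous_attains_inf[OF K _ bcont] u by blast
  have "h b m \<le> h s u" if "s \<in> {a<..<b}" for s
    using step[OF that] m by force
  moreover have "((\<lambda>s. h s u) \<longlongrightarrow> h a u) (at a within {a..b})"
  proof -
    have ta: "(f \<longlongrightarrow> f a) (at a within {a..b})" if "continuous_on {a..b} f" for f :: "real \<Rightarrow> real"
      using that ab by (simp add: continuous_on_def)
    show ?thesis
      unfolding hu
      by (intro tendsto_intros ta[OF cont(1)] ta[OF cont(2)] ta[OF lcont] ta[OF wcont])
        (use x0(2) in simp)
  qed
  moreover have "eventually (\<lambda>s. s \<in> {a<..<b}) (at a within {a..b})"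
    using ab by (auto simp: eventually_at intro!: exI[of _ "b - a"] simp: dist_real_def)
  moreover have "at a within {a..b} \<noteq> bot"
    using ab by (simp add: trivial_limit_within islimpt_Icc)
  ultimately have "h b m \<le> h a u"
    by (intro tendsto_lowerbound[of "\<lambda>s. h s u" "h a u"]) (auto elim: eventually_mono)
  also have "\<dots> \<le> 0"
    unfolding hu using wpos[of a] x0 by (simp add: mult_le_0_iff divide_le_eq)
  finally have "N b m m / P b m m \<le> l b"
    using wpos[of b] by (simp add: h_def mult_le_0_iff not_le[symmetric])
  then have "N b m m \<le> l b * P b m m"
    using pos[of b m] ab KE[OF m(1)] by (simp add: divide_le_eq)
  then show ?thesis using m(1) KE by blast
qed

text \<open>
  The quotient is homogeneous of degree zero, so its values are those on a compact set, the product of the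
  interval and the unit sphere of \<open>E\<close>.
\<close>

lemma rayleigh_quotient_bounded_below:
  fixes N P :: "real \<Rightarrow> 'v::euclidean_space \<Rightarrow> 'v \<Rightarrow> real"
  assumes E: "subspace E"
    and bil: "\<And>t. bilinear (N t)" "\<And>t. bilinear (P t)"
    and cont: "\<And>x y. continuous_on {a..b} (\<lambda>t. N t x y)" "\<And>x y. continuous_on {a..b} (\<lambda>t. P t x y)"
    and pos: "\<And>t x. t \<in> {a..b} \<Longrightarrow> x \<in> E \<Longrightarrow> x \<noteq> 0 \<Longrightarrow> P t x x > 0"
  shows "\<exists>m. \<forall>t\<in>{a..b}. \<forall>x\<in>E. m * P t x x \<le> N t x x"
proof -
  define K where "K = {a..b} \<times> (sphere 0 1 \<inter> E)"
  have "compact K" unfolding K_def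
    using E by (intro compact_Times compact_Int_closed) (auto intro: closed_subspace)
  moreover have "continuous_on K (\<lambda>z. N (fst z) (snd z) (snd z) / P (fst z) (snd z) (snd z))"
  proof (intro continuous_on_divide ballI)
    fix z assume "z \<in> K"
    then have "P (fst z) (snd z) (snd z) > 0"
      by (intro pos) (auto simp: K_def)
    then show "P (fst z) (snd z) (snd z) \<noteq> 0" by simp
  qed (simp_all add: K_def bilinear_diagonal_continuous bil cont)
  ultimately have "bounded ((\<lambda>z. N (fst z) (snd z) (snd z) / P (fst z) (snd z) (snd z)) ` K)"
    by (simp add: compact_continuous_image compact_imp_bounded)
  then obtain M where M: "\<And>z. z \<in> K \<Longrightarrow> \<bar>N (fst z) (snd z) (snd z) / P (fst z) (snd z) (snd z)\<bar> \<le> M"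
    unfolding bounded_iff by auto
  have "- M * P t x x \<le> N t x x" if t: "t \<in> {a..b}" and x: "x \<in> E" for t x
  proof (cases "x = 0")
    case True
    then show ?thesis by (simp add: bilinear_lzero[OF bil(1)] bilinear_lzero[OF bil(2)])
  next
    case False
    have "(t, x /\<^sub>R norm x) \<in> K" using False t x E by (simp add: K_def subspace_scale)
    from M[OF this] have "\<bar>N t x x / P t x x\<bar> \<le> M"
      using False by (simp add: bilinear_lmul[OF bil(1)] bilinear_rmul[OF bil(1)]
        bilinear_lmul[OF bil(2)] bilinear_rmul[OF bil(2)])
    then have "- M \<le> N t x x / P t x x" by linarith
    then show ?thesis using pos[OF t x False] by (simp add: pos_le_divide_eq)
  qed
  then show ?thesis by blast
qed

section \<open>Second differences and differentiable matrix functions\<close>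

text \<open>
  For fixed \<open>h\<close>, the second difference is the increment over \<open>[0, h]\<close> of
  \<open>s \<mapsto> f (x + s u + h v) - f (x + s u)\<close>, so by the mean value theorem it is \<open>h\<close> times a difference of two values of
  \<open>\<lambda>y. f' y u\<close>, and differentiability at the single point \<open>x\<close> evaluates this
  difference up to an error \<open>o(h)\<close>.
\<close>

lemma second_difference_tendsto:
  fixes f :: "'a::real_normed_vector \<Rightarrow> real"
  assumes S: "open S" "x \<in> S"
    and f: "\<And>y. y \<in> S \<Longrightarrow> (f has_derivative f' y) (at y)"
    and A: "((\<lambda>y. f' y u) has_derivative A) (at x)"
  shows "((\<lambda>h. (f (x + h *\<^sub>R u + h *\<^sub>R v) - f (x + h *\<^sub>R u) - f (x + h *\<^sub>R v) + f x) / h\<^sup>2)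
    \<longlongrightarrow> A v) (at_right 0)"
proof (rule tendstoI)
  fix e :: real assume e: "e > 0"
  interpret A: bounded_linear A using A by (rule has_derivative_bounded_linear)
  define L where "L = norm u + norm v + 1"
  have L: "L > 0" "norm u \<le> L" "norm v \<le> L" "norm u + norm v \<le> L"
    unfolding L_def by (simp_all add: add_nonneg_pos)
  define e' where "e' = e / (4 * L)"
  have e': "e' > 0" using e L by (simp add: e'_def)
  obtain d1 where d1: "d1 > 0" "\<And>y. dist y x < d1 \<Longrightarrow> y \<in> S"
    using S unfolding open_dist by blast
  obtain d2 where d2: "d2 > 0"
    "\<And>y. norm (y - x) < d2 \<Longrightarrow> norm (f' y u - f' x u - A (y - x)) \<le> e' * norm (y - x)"
    using A e' unfolding has_derivative_at_alt by blast
  define d where "d = min d1 d2 / L"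
  have d: "d > 0" using d1 d2 L by (simp add: d_def)
  have "\<bar>(f (x + h *\<^sub>R u + h *\<^sub>R v) - f (x + h *\<^sub>R u) - f (x + h *\<^sub>R v) + f x) / h\<^sup>2 - A v\<bar> < e"
    if h: "0 < h" "h < d" for h
  proof -
    have small: "norm (s *\<^sub>R u + r *\<^sub>R v) \<le> h * L \<and> h * L < min d1 d2"
      if "0 \<le> s" "s \<le> h" "0 \<le> r" "r \<le> h" for s r
    proof
      have "norm (s *\<^sub>R u + r *\<^sub>R v) \<le> s * norm u + r * norm v"
        using norm_triangle_ineq[of "s *\<^sub>R u" "r *\<^sub>R v"] that by simp
      also have "\<dots> \<le> h * norm u + h * norm v"
        using that by (intro add_mono mult_right_mono) auto
      also have "\<dots> \<le> h * L" using L(4) h(1) by (simp flip: distrib_left)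
      finally show "norm (s *\<^sub>R u + r *\<^sub>R v) \<le> h * L" .
      show "h * L < min d1 d2" using h L by (simp add: d_def pos_less_divide_eq)
    qed
    define p where "p r s = x + (s *\<^sub>R u + r *\<^sub>R v)" for r s
    have pS: "p r s \<in> S" if "0 \<le> s" "s \<le> h" "0 \<le> r" "r \<le> h" for r s
      using small[OF that] by (intro d1) (auto simp: p_def dist_norm)
    have der: "((\<lambda>s. f (p r s)) has_real_derivative f' (p r s) u) (at s)"
      if "0 \<le> s" "s \<le> h" "0 \<le> r" "r \<le> h" for r s
    proof -
      have "((\<lambda>s. p r s) has_derivative (\<lambda>k. k *\<^sub>R u)) (at s)"
        unfolding p_def by (auto intro!: derivative_eq_intros)
      from diff_chain_at[OF this f[OF pS[OF that]]]
      have "((\<lambda>s. f (p r s)) has_derivative (\<lambda>k. f' (p r s) (k *\<^sub>R u))) (at s)"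
        by (simp add: o_def)
      moreover have "f' (p r s) (k *\<^sub>R u) = k * f' (p r s) u" for k
        using linear_cmul[OF has_derivative_linear[OF f[OF pS[OF that]]]] by simp
      ultimately show ?thesis by (simp add: has_field_derivative_def mult_commute_abs)
    qed
    have "\<exists>s. 0 < s \<and> s < h \<and> (f (p h h) - f (p 0 h)) - (f (p h 0) - f (p 0 0))
      = (h - 0) * (f' (p h s) u - f' (p 0 s) u)"
      using h by (intro MVT2[of 0 h "\<lambda>s. f (p h s) - f (p 0 s)"]) (auto intro!: derivative_intros der)
    then obtain s where s: "0 < s" "s < h"
      "(f (p h h) - f (p 0 h)) - (f (p h 0) - f (p 0 0)) = h * (f' (p h s) u - f' (p 0 s) u)"
      by auto
    have app: "\<bar>f' (p r s) u - f' x u - A (s *\<^sub>R u + r *\<^sub>R v)\<bar> \<le> e' * (h * L)"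
      if "0 \<le> r" "r \<le> h" for r
    proof -
      have "norm (f' (p r s) u - f' x u - A (p r s - x)) \<le> e' * norm (p r s - x)"
        using small[of s r] s that by (intro d2) (auto simp: p_def)
      also have "\<dots> \<le> e' * (h * L)"
        using small[of s r] s that e' by (intro mult_left_mono) (auto simp: p_def)
      finally show ?thesis by (simp add: p_def)
    qed
    have "f' (p h s) u - f' (p 0 s) u - h * A v =
        (f' (p h s) u - f' x u - A (s *\<^sub>R u + h *\<^sub>R v)) - (f' (p 0 s) u - f' x u - A (s *\<^sub>R u + 0 *\<^sub>R v))"
      by (simp add: A.add A.scaleR)
    then have "\<bar>f' (p h s) u - f' (p 0 s) u - h * A v\<bar> \<le> 2 * (e' * (h * L))"
      using app[of h] app[of 0] h(1) by linarith
    then have "\<bar>h * (f' (p h s) u - f' (p 0 s) u) - h\<^sup>2 * A v\<bar> \<le> h * (2 * (e' * (h * L)))"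
      using h(1) by (simp add: power2_eq_square abs_mult mult.assoc flip: right_diff_distrib)
    also have "\<dots> = h\<^sup>2 * (e / 2)" using L by (simp add: e'_def power2_eq_square)
    also have "\<dots> < h\<^sup>2 * e" using h(1) e by simp
    finally have "\<bar>(f (p h h) - f (p 0 h) - f (p h 0) + f (p 0 0)) - h\<^sup>2 * A v\<bar> < h\<^sup>2 * e"
      using s(3) by (simp add: algebra_simps)
    then have "\<bar>h\<^sup>2 * ((f (p h h) - f (p 0 h) - f (p h 0) + f (p 0 0)) / h\<^sup>2 - A v)\<bar> < h\<^sup>2 * e"
      using h(1) by (simp add: right_diff_distrib)
    then show ?thesis
      using h(1) by (simp add: abs_mult p_def add.assoc)
  qed
  then show "\<forall>\<^sub>F h in at_right 0.
      dist ((f (x + h *\<^sub>R u + h *\<^sub>R v) - f (x + h *\<^sub>R u) - f (x + h *\<^sub>R v) + f x) / h\<^sup>2) (A v) < e"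
    using d unfolding eventually_at_right_field dist_real_def by blast
qed

text \<open>
  The second difference is symmetric in \<open>u\<close> and \<open>v\<close>, so its two limits agree.
\<close>

lemma mixed_second_derivatives_commute:
  fixes f :: "'a::real_normed_vector \<Rightarrow> real"
  assumes "open S" "x \<in> S" "\<And>y. y \<in> S \<Longrightarrow> (f has_derivative f' y) (at y)"
    and "((\<lambda>y. f' y u) has_derivative A) (at x)"
    and "((\<lambda>y. f' y v) has_derivative B) (at x)"
  shows "A v = B u"
proof (rule tendsto_unique)
  let ?\<Delta> = "\<lambda>h. (f (x + h *\<^sub>R u + h *\<^sub>R v) - f (x + h *\<^sub>R u) - f (x + h *\<^sub>R v) + f x) / h\<^sup>2"
  show "(?\<Delta> \<longlongrightarrow> A v) (at_right 0)"
    using assms(1-4) by (rule second_difference_tendsto)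
  have "((\<lambda>h. (f (x + h *\<^sub>R v + h *\<^sub>R u) - f (x + h *\<^sub>R v) - f (x + h *\<^sub>R u) + f x) / h\<^sup>2) \<longlongrightarrow> B u)
      (at_right 0)"
    using assms(1-3,5) by (rule second_difference_tendsto)
  then show "(?\<Delta> \<longlongrightarrow> B u) (at_right 0)"
    by (simp add: algebra_simps)
qed simp

lemma differentiable_transform_open:
  assumes "f differentiable (at x)" "open S" "x \<in> S" "\<And>y. y \<in> S \<Longrightarrow> f y = h y"
  shows "h differentiable (at x)"
proof -
  obtain D where "(f has_derivative D) (at x)" using assms(1) by (auto simp: differentiable_def)
  then have "(h has_derivative D) (at x)"
    by (rule has_derivative_transform_within_open[OF _ assms(2-4)])
  then show ?thesis by (rule differentiableI)
qed

lemma differentiable_vec_nth: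
  fixes f :: "'a::real_normed_vector \<Rightarrow> 'b::real_normed_vector ^ 'n"
  assumes "f differentiable (at x)"
  shows "(\<lambda>y. f y $ i) differentiable (at x)"
  using bounded_linear.has_derivative[OF bounded_linear_vec_nth assms[unfolded frechet_derivative_works]]
  by (rule differentiableI)

lemma differentiable_vec_lambda:
  fixes f :: "'k::finite \<Rightarrow> real \<Rightarrow> real"
  assumes "\<And>k. f k differentiable (at t)"
  shows "(\<lambda>s. \<chi> k. f k s) differentiable (at t)"
proof -
  have "(\<lambda>s. \<chi> k. f k s) = (\<lambda>s. \<Sum>k\<in>UNIV. f k s *\<^sub>R axis k 1)"
    by (auto simp: vec_eq_iff axis_def if_distrib[of "\<lambda>z. _ * z"] cong: if_cong)
  moreover have "(\<lambda>s. \<Sum>k\<in>UNIV. f k s *\<^sub>R (axis k 1 :: real ^ 'k)) differentiable (at t)"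
    by (intro differentiable_sum differentiable_scaleR assms differentiable_const ballI) auto
  ultimately show ?thesis by simp
qed

lemma sum_move_inner3:
  "(\<Sum>a\<in>A. \<Sum>b\<in>B. \<Sum>c\<in>C. f a b c) = (\<Sum>b\<in>B. \<Sum>c\<in>C. \<Sum>a\<in>A. f a b c)"
  by (rule trans[OF sum.swap sum.cong[OF refl sum.swap]])

lemma sum_move_inner4:
  "(\<Sum>a\<in>A. \<Sum>b\<in>B. \<Sum>c\<in>C. \<Sum>d\<in>D. f a b c d) = (\<Sum>b\<in>B. \<Sum>c\<in>C. \<Sum>d\<in>D. \<Sum>a\<in>A. f a b c d)"
  by (rule trans[OF sum.swap sum.cong[OF refl sum_move_inner3]])

lemma sum_move_inner5:
  "(\<Sum>a\<in>A. \<Sum>b\<in>B. \<Sum>c\<in>C. \<Sum>d\<in>D. \<Sum>e\<in>E. f a b c d e) =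
   (\<Sum>b\<in>B. \<Sum>c\<in>C. \<Sum>d\<in>D. \<Sum>e\<in>E. \<Sum>a\<in>A. f a b c d e)"
  by (rule trans[OF sum.swap sum.cong[OF refl sum_move_inner4]])

lemma differentiable_det:
  fixes M :: "'a::real_normed_vector \<Rightarrow> real^'n^'n"
  assumes "\<And>i j. (\<lambda>y. M y $ i $ j) differentiable (at x)"
  shows "(\<lambda>y. det (M y)) differentiable (at x)"
proof -
  have "(\<lambda>y. \<Prod>i\<in>UNIV. M y $ i $ p i) differentiable (at x)" for p :: "'n \<Rightarrow> 'n"
    by (rule differentiableI, rule has_derivative_prod)
      (rule assms[unfolded frechet_derivative_works])
  then show ?thesis
    unfolding det_def by (intro differentiable_sum differentiable_mult differentiable_const) auto
qed

lemma invertible_matrix_inv: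
  fixes M :: "real^'n^'n"
  assumes "invertible M"
  shows "M ** matrix_inv M = mat 1" "matrix_inv M ** M = mat 1"
  using assms unfolding invertible_def matrix_inv_def by (metis (mono_tags, lifting) someI_ex)+

text \<open>
  By Cramer's rule an entry of the inverse is a quotient of two determinants.
\<close>

lemma differentiable_matrix_inv_entry:
  fixes M :: "'a::real_normed_vector \<Rightarrow> real^'n^'n"
  assumes S: "open S" "x \<in> S" and inv: "\<And>y. y \<in> S \<Longrightarrow> invertible (M y)"
    and diff: "\<And>i j. (\<lambda>y. M y $ i $ j) differentiable (at x)"
  shows "(\<lambda>y. matrix_inv (M y) $ k $ l) differentiable (at x)"
proof -
  let ?C = "\<lambda>y. (\<chi> i j. if j = k then axis l 1 $ i else M y $ i $ j) :: real^'n^'n"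
  have eq: "det (?C y) / det (M y) = matrix_inv (M y) $ k $ l" if "y \<in> S" for y
  proof -
    have "M y *v (matrix_inv (M y) *v axis l 1) = axis l 1"
      using invertible_matrix_inv(1)[OF inv[OF that]] by (simp add: matrix_vector_mul_assoc)
    then have "matrix_inv (M y) *v axis l 1 = (\<chi> k. det (\<chi> i j. if j = k then axis l 1 $ i else M y $ i $ j) / det (M y))"
      using cramer[of "M y"] inv[OF that] by (simp add: invertible_det_nz)
    then have "(matrix_inv (M y) *v axis l 1) $ k = det (?C y) / det (M y)" by simp
    then show ?thesis by (simp add: matrix_vector_mul_component inner_axis)
  qed
  have "(\<lambda>y. det (?C y)) differentiable (at x)"
  proof (rule differentiable_det)
    fix i j show "(\<lambda>y. ?C y $ i $ j) differentiable (at x)"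
      by (cases "j = k") (simp_all add: diff)
  qed
  moreover have "det (M x) \<noteq> 0" using inv[OF S(2)] by (simp add: invertible_det_nz)
  ultimately have "(\<lambda>y. det (?C y) / det (M y)) differentiable (at x)"
    using differentiable_det[OF diff] by (intro differentiable_divide)
  then show ?thesis
    by (rule differentiable_transform_open[OF _ S eq])
qed

section \<open>Metric compatibility and curvature symmetry in one chart\<close>

lemma smooth_on_has_derivative:
  assumes "smooth_on S f" "open S" "x \<in> S"
  shows "(f has_derivative frechet_derivative f (at x)) (at x)"
proof -
  have "Ck_on (Suc 0) S f" using assms(1) by (simp only: smooth_on_def)
  then show ?thesis
    using assms(2,3) by (simp add: differentiable_on_eq_differentiable_at frechet_derivative_works)
qed

lemma smooth_on_derivative_differentiable:
  assumes "smooth_on S f" "open S" "x \<in> S"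
  shows "(\<lambda>y. frechet_derivative f (at y) v) differentiable (at x)"
proof -
  have "Ck_on (Suc (Suc 0)) S f" using assms(1) by (simp only: smooth_on_def)
  then show ?thesis
    using assms(2,3) by (simp add: differentiable_on_eq_differentiable_at)
qed

text \<open>
  The part of a Riemannian metric that is seen in one chart, with \<open>V\<close> the image of the chart.
\<close>

locale coordinate_metric =
  fixes g :: "('m, 'n::finite) mtensor" and c :: "('m, 'n) chart" and V :: "(real ^ 'n) set"
  assumes open_domain: "open V" and smooth: "smooth_on V (g c)"
    and symmetric: "\<And>x. x \<in> V \<Longrightarrow> transpose (g c x) = g c x"
    and positive: "\<And>x v. x \<in> V \<Longrightarrow> v \<noteq> 0 \<Longrightarrow> v \<bullet> (g c x *v v) > 0"
begin

text \<open>
  \<open>metric_deriv x i j k\<close> is \<open>\<partial>\<^sub>i g\<^sub>j\<^sub>k\<close> at \<open>x\<close>. It is defined through the derivative of the whole matrix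
  because smoothness of the metric is given for the matrix-valued map.
\<close>

definition metric_deriv :: "real ^ 'n \<Rightarrow> 'n \<Rightarrow> 'n \<Rightarrow> 'n \<Rightarrow> real" where
  "metric_deriv x i j k = frechet_derivative (g c) (at x) (axis i 1) $ j $ k"

lemma sym_entry: "x \<in> V \<Longrightarrow> g c x $ i $ j = g c x $ j $ i"
  using symmetric[of x] by (metis transpose_def vec_lambda_beta)

lemma invertible: assumes "x \<in> V" shows "invertible (g c x)"
proof -
  have "v = 0" if "g c x *v v = 0" for v
    using positive[OF assms, of v] that by (cases "v = 0") auto
  then show ?thesis
    by (simp add: invertible_left_inverse matrix_left_invertible_ker)
qed

lemma entry_has_derivative:
  assumes "x \<in> V"
  shows "((\<lambda>y. g c y $ j $ k) has_derivative (\<lambda>u. frechet_derivative (g c) (at x) u $ j $ k)) (at x)"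
  using smooth_on_has_derivative[OF smooth open_domain assms]
  by (intro bounded_linear.has_derivative[OF bounded_linear_vec_nth])

lemma partial_entry: "x \<in> V \<Longrightarrow> partial i (\<lambda>y. g c y $ j $ k) x = metric_deriv x i j k"
  using frechet_derivative_at[OF entry_has_derivative[of x j k]]
  by (simp add: partial_def metric_deriv_def fun_eq_iff)

lemma metric_deriv_sym:
  assumes "x \<in> V" shows "metric_deriv x i j k = metric_deriv x i k j"
proof -
  have "((\<lambda>y. g c y $ j $ k) has_derivative (\<lambda>u. frechet_derivative (g c) (at x) u $ k $ j)) (at x)"
    by (rule has_derivative_transform_within_open[OF entry_has_derivative[OF assms, of k j] open_domain assms])
      (rule sym_entry)
  from has_derivative_unique[OF this entry_has_derivative[OF assms, of j k]]
  show ?thesis by (simp add: metric_deriv_def fun_eq_iff)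
qed

lemma differentiable_metric_deriv:
  assumes "x \<in> V" shows "(\<lambda>y. metric_deriv y i j k) differentiable (at x)"
proof -
  have "(\<lambda>y. frechet_derivative (g c) (at y) (axis i 1)) differentiable (at x)"
    by (rule smooth_on_derivative_differentiable[OF smooth open_domain assms])
  then show ?thesis unfolding metric_deriv_def by (intro differentiable_vec_nth)
qed

lemma christoffel_eq:
  assumes "x \<in> V"
  shows "christoffel g c x k i j = (\<Sum>l\<in>UNIV. matrix_inv (g c x) $ k $ l *
        (metric_deriv x i j l + metric_deriv x j i l - metric_deriv x l i j)) / 2"
  using assms by (simp add: christoffel_def partial_entry)

lemma differentiable_christoffel:
  assumes "x \<in> V" shows "(\<lambda>y. christoffel g c y k i j) differentiable (at x)"
proof -
  have "(\<lambda>y. g c y $ i $ j) differentiable (at x)" for i j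
    using entry_has_derivative[OF assms] by (rule differentiableI)
  then have "(\<lambda>y. matrix_inv (g c y) $ k $ l) differentiable (at x)" for k l
    by (intro differentiable_matrix_inv_entry[OF open_domain assms invertible])
  then have "(\<lambda>y. (\<Sum>l\<in>UNIV. matrix_inv (g c y) $ k $ l *
        (metric_deriv y i j l + metric_deriv y j i l - metric_deriv y l i j)) / 2) differentiable (at x)"
    by (intro differentiable_divide differentiable_sum differentiable_mult differentiable_add
        differentiable_diff differentiable_metric_deriv assms differentiable_const ballI) auto
  then show ?thesis
    by (rule differentiable_transform_open[OF _ open_domain assms]) (simp add: christoffel_eq)
qed

text \<open>
  Multiplying by the metric cancels its inverse, which leaves the Christoffel symbols of the first
  kind.
\<close>

lemma christoffel_lowered:
  assumes x: "x \<in> V"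
  shows "(\<Sum>m\<in>UNIV. christoffel g c x m i j * g c x $ m $ k)
    = (metric_deriv x i j k + metric_deriv x j i k - metric_deriv x k i j) / 2"
proof -
  let ?X = "\<lambda>l. metric_deriv x i j l + metric_deriv x j i l - metric_deriv x l i j"
  have inv: "(\<Sum>m\<in>UNIV. g c x $ k $ m * matrix_inv (g c x) $ m $ l) = (if k = l then 1 else 0)" for l
    using invertible_matrix_inv(1)[OF invertible[OF x]]
    by (simp add: matrix_matrix_mult_def mat_def vec_eq_iff)
  have "(\<Sum>m\<in>UNIV. christoffel g c x m i j * g c x $ m $ k)
      = (\<Sum>m\<in>UNIV. \<Sum>l\<in>UNIV. g c x $ k $ m * matrix_inv (g c x) $ m $ l * ?X l) / 2"
    by (simp add: christoffel_eq[OF x] sum_divide_distrib sum_distrib_left sum_distrib_right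
        sym_entry[OF x, of _ k] ac_simps)
  also have "\<dots> = (\<Sum>l\<in>UNIV. (\<Sum>m\<in>UNIV. g c x $ k $ m * matrix_inv (g c x) $ m $ l) * ?X l) / 2"
    by (subst sum.swap) (simp add: sum_distrib_right)
  also have "\<dots> = ?X k / 2" by (simp add: inv if_distrib[of "\<lambda>z. z * _"] cong: if_cong)
  finally show ?thesis .
qed

text \<open>
  In the sum of the two lowered symbols all terms other than \<open>\<partial>\<^sub>i g\<^sub>j\<^sub>k\<close> cancel.
\<close>

lemma metric_compatible:
  assumes x: "x \<in> V"
  shows "metric_deriv x i j k =
    (\<Sum>m\<in>UNIV. christoffel g c x m i j * g c x $ m $ k) +
    (\<Sum>m\<in>UNIV. christoffel g c x m i k * g c x $ m $ j)"
  unfolding christoffel_lowered[OF x]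
  using metric_deriv_sym[OF x, of i k j] metric_deriv_sym[OF x, of j k i] metric_deriv_sym[OF x, of k i j]
  by (simp add: field_simps)

lemma partial_metric_deriv:
  assumes x: "x \<in> V"
  shows "frechet_derivative (\<lambda>y. metric_deriv y j k m) (at x) (axis i 1) =
    (\<Sum>l\<in>UNIV. partial i (\<lambda>y. christoffel g c y l j k) x * g c x $ l $ m + christoffel g c x l j k * metric_deriv x i l m) +
    (\<Sum>l\<in>UNIV. partial i (\<lambda>y. christoffel g c y l j m) x * g c x $ l $ k + christoffel g c x l j m * metric_deriv x i l k)"
proof -
  let ?D = "\<lambda>l i j. frechet_derivative (\<lambda>y. christoffel g c y l i j) (at x)"
  have Gam: "((\<lambda>y. christoffel g c y l i j) has_derivative ?D l i j) (at x)" for l i j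
    using differentiable_christoffel[OF x] by (simp add: frechet_derivative_works)
  have "((\<lambda>y. (\<Sum>l\<in>UNIV. christoffel g c y l j k * g c y $ l $ m) + (\<Sum>l\<in>UNIV. christoffel g c y l j m * g c y $ l $ k))
     has_derivative (\<lambda>u.
     (\<Sum>l\<in>UNIV. christoffel g c x l j k * frechet_derivative (g c) (at x) u $ l $ m + ?D l j k u * g c x $ l $ m) +
     (\<Sum>l\<in>UNIV. christoffel g c x l j m * frechet_derivative (g c) (at x) u $ l $ k + ?D l j m u * g c x $ l $ k))) (at x)"
    by (intro has_derivative_add has_derivative_sum has_derivative_mult Gam entry_has_derivative x)
  then have "((\<lambda>y. metric_deriv y j k m) has_derivative (\<lambda>u.
     (\<Sum>l\<in>UNIV. christoffel g c x l j k * frechet_derivative (g c) (at x) u $ l $ m + ?D l j k u * g c x $ l $ m) +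
     (\<Sum>l\<in>UNIV. christoffel g c x l j m * frechet_derivative (g c) (at x) u $ l $ k + ?D l j m u * g c x $ l $ k))) (at x)"
    by (rule has_derivative_transform_within_open[OF _ open_domain x]) (simp add: metric_compatible)
  from frechet_derivative_at[OF this, symmetric]
  show ?thesis by (simp add: partial_def metric_deriv_def add.commute)
qed

lemma partial_metric_deriv_commute:
  assumes x: "x \<in> V"
  shows "frechet_derivative (\<lambda>y. metric_deriv y j k m) (at x) (axis i 1) =
    frechet_derivative (\<lambda>y. metric_deriv y i k m) (at x) (axis j 1)"
  by (rule mixed_second_derivatives_commute[OF open_domain x entry_has_derivative[of _ k m]])
    (use differentiable_metric_deriv[OF x] in \<open>simp_all add: frechet_derivative_works flip: metric_deriv_def\<close>)

lemma curvature_coeff_antisym: "curvature_coeff g c x l j i k = - curvature_coeff g c x l i j k"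
  by (simp add: curvature_coeff_def sum_subtractf)

text \<open>
  The curvature tensor with all indices lowered: \<open>\<langle>R(e\<^sub>i, e\<^sub>j) e\<^sub>k, e\<^sub>m\<rangle>\<close>.
\<close>

definition curvature4 :: "real ^ 'n \<Rightarrow> 'n \<Rightarrow> 'n \<Rightarrow> 'n \<Rightarrow> 'n \<Rightarrow> real" where
  "curvature4 x i j k m = (\<Sum>l\<in>UNIV. curvature_coeff g c x l i j k * g c x $ l $ m)"

lemma curvature4_antisym_first: "curvature4 x j i k m = - curvature4 x i j k m"
  unfolding curvature4_def curvature_coeff_antisym[of x _ j i] by (simp add: sum_negf)

text \<open>
  In terms of the matrices \<open>\<Gamma>\<^sub>i\<close>, compatibility reads \<open>\<partial>\<^sub>i g = \<Gamma>\<^sub>i\<^sup>T g + g \<Gamma>\<^sub>i\<close>. Differentiating once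
  more and using \<open>\<partial>\<^sub>i \<partial>\<^sub>j g = \<partial>\<^sub>j \<partial>\<^sub>i g\<close> gives \<open>R\<^sub>i\<^sub>j\<^sup>T g + g R\<^sub>i\<^sub>j = 0\<close>.
\<close>

lemma curvature4_antisym_last:
  assumes x: "x \<in> V"
  shows "curvature4 x i j m k = - curvature4 x i j k m"
proof -
  let ?G = "g c x" and ?C = "christoffel g c x"
  let ?d = "\<lambda>i l j k. partial i (\<lambda>y. christoffel g c y l j k) x"
  \<comment> \<open>\<open>Q\<close> collects the products that occur in the curvature; \<open>T\<close> the mixed terms
    \<open>\<Gamma>\<^sub>i\<^sup>T g \<Gamma>\<^sub>j\<close>, which cancel when \<open>i\<close> and \<open>j\<close> are exchanged.\<close>
  define Q where "Q i j k m = (\<Sum>l\<in>UNIV. \<Sum>p\<in>UNIV. ?C l j k * ?C p i l * ?G $ p $ m)" for i j k m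
  define T where "T i j k m = (\<Sum>l\<in>UNIV. \<Sum>p\<in>UNIV. ?C l j k * ?C p i m * ?G $ p $ l)" for i j k m
  have T: "T i j k m = T j i m k" for i j k m
    unfolding T_def by (subst sum.swap) (simp add: sym_entry[OF x] ac_simps)
  have expand: "(\<Sum>l\<in>UNIV. ?d i l j k * ?G $ l $ m + ?C l j k * metric_deriv x i l m)
      = (\<Sum>l\<in>UNIV. ?d i l j k * ?G $ l $ m) + Q i j k m + T i j k m" for i j k m
    by (simp add: metric_compatible[OF x] Q_def T_def sum.distrib sum_distrib_left distrib_left mult.assoc)
  have R: "curvature4 x i j k m = (\<Sum>l\<in>UNIV. ?d i l j k * ?G $ l $ m) - (\<Sum>l\<in>UNIV. ?d j l i k * ?G $ l $ m)
      + Q i j k m - Q j i k m" for i j k m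
  proof -
    have Q': "Q i j k m = (\<Sum>l\<in>UNIV. \<Sum>p\<in>UNIV. ?C l i p * ?C p j k * ?G $ l $ m)" for i j
      unfolding Q_def by (subst sum.swap) (simp add: ac_simps)
    show ?thesis
      unfolding Q' curvature4_def curvature_coeff_def
      by (simp add: sum_subtractf sum.distrib sum_distrib_left sum_distrib_right algebra_simps)
  qed
  show ?thesis
    using partial_metric_deriv_commute[OF x, of j k m i]
    unfolding partial_metric_deriv[OF x] expand R
    using T[of i j k m] T[of i j m k] by linarith
qed

text \<open>
  Exchanging both the first and the last pair of indices changes the sign twice.
\<close>

lemma curvature_inner_swap:
  fixes X Y :: "real ^ 'n"
  assumes x: "x \<in> V"
  defines "R \<equiv> \<lambda>X Y Z. \<chi> l. \<Sum>i\<in>UNIV. \<Sum>j\<in>UNIV. \<Sum>k\<in>UNIV. curvature_coeff g c x l i j k * (X $ i) * (Y $ j) * (Z $ k)"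
  shows "R X Y Y \<bullet> (g c x *v X) = R Y X X \<bullet> (g c x *v Y)"
proof -
  have R: "R X Y Z \<bullet> (g c x *v W) =
      (\<Sum>i\<in>UNIV. \<Sum>j\<in>UNIV. \<Sum>k\<in>UNIV. \<Sum>m\<in>UNIV. curvature4 x i j k m * (X $ i * Y $ j * Z $ k * W $ m))" for X Y Z W
  proof -
    have "R X Y Z \<bullet> (g c x *v W) = (\<Sum>l\<in>UNIV. \<Sum>i\<in>UNIV. \<Sum>j\<in>UNIV. \<Sum>k\<in>UNIV. \<Sum>m\<in>UNIV.
       curvature_coeff g c x l i j k * g c x $ l $ m * (X $ i * Y $ j * Z $ k * W $ m))"
      by (simp add: R_def inner_vec_def matrix_vector_mult_def sum_distrib_left sum_distrib_right ac_simps)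
    also have "\<dots> = (\<Sum>i\<in>UNIV. \<Sum>j\<in>UNIV. \<Sum>k\<in>UNIV. \<Sum>m\<in>UNIV. \<Sum>l\<in>UNIV.
       curvature_coeff g c x l i j k * g c x $ l $ m * (X $ i * Y $ j * Z $ k * W $ m))"
      by (rule sum_move_inner5)
    finally show ?thesis by (simp add: curvature4_def sum_distrib_right)
  qed
  have "R X Y Y \<bullet> (g c x *v X) = (\<Sum>j\<in>UNIV. \<Sum>i\<in>UNIV. \<Sum>k\<in>UNIV. \<Sum>m\<in>UNIV. curvature4 x i j k m * (X $ i * Y $ j * Y $ k * X $ m))"
    unfolding R by (rule sum.swap)
  also have "\<dots> = (\<Sum>j\<in>UNIV. \<Sum>i\<in>UNIV. \<Sum>m\<in>UNIV. \<Sum>k\<in>UNIV. curvature4 x i j k m * (X $ i * Y $ j * Y $ k * X $ m))"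
    by (rule sum.cong[OF refl], rule sum.cong[OF refl], rule sum.swap)
  also have "\<dots> = R Y X X \<bullet> (g c x *v Y)"
    unfolding R
  proof (intro sum.cong refl)
    fix j i m k
    have "curvature4 x i j k m = curvature4 x j i m k"
      using curvature4_antisym_first[of x j i k m] curvature4_antisym_last[OF x, of j i m k] by simp
    then show "curvature4 x i j k m * (X $ i * Y $ j * Y $ k * X $ m) = curvature4 x j i m k * (Y $ j * X $ i * X $ m * Y $ k)"
      by simp
  qed
  finally show ?thesis .
qed

lemma inner_metric_sym: "x \<in> V \<Longrightarrow> v \<bullet> (g c x *v w) = w \<bullet> (g c x *v v)"
  by (metis dot_lmul_matrix inner_commute symmetric transpose_matrix_vector)

text \<open>
  The product rule for the metric along a curve: the derivative of the matrix of the metric is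
  distributed over the two vectors by compatibility, and \<open>\<Gamma>\<close> turns \<open>v'\<close> and \<open>w'\<close> into covariant
  derivatives.
\<close>

lemma inner_along_curve_has_derivative:
  fixes y :: "real \<Rightarrow> real ^ 'n"
  assumes yV: "y t \<in> V" and y: "(y has_vector_derivative y') (at t)"
    and v: "(v has_vector_derivative v') (at t)" and w: "(w has_vector_derivative w') (at t)"
  defines "\<Gamma> \<equiv> \<lambda>z. \<chi> k. \<Sum>i\<in>UNIV. \<Sum>j\<in>UNIV. christoffel g c (y t) k i j * (y' $ i) * (z $ j)"
  shows "((\<lambda>s. v s \<bullet> (g c (y s) *v w s)) has_real_derivative
    (v' + \<Gamma> (v t)) \<bullet> (g c (y t) *v w t) + v t \<bullet> (g c (y t) *v (w' + \<Gamma> (w t)))) (at t)"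
proof -
  let ?G = "g c (y t)" and ?G' = "frechet_derivative (g c) (at (y t)) y'"
  let ?C = "christoffel g c (y t)"
  have lin: "linear (frechet_derivative (g c) (at (y t)))"
    using has_derivative_linear[OF smooth_on_has_derivative[OF smooth open_domain yV]] .
  have entry: "((\<lambda>s. g c (y s) $ j $ k) has_real_derivative ?G' $ j $ k) (at t)" for j k
  proof -
    have "((\<lambda>s. g c (y s) $ j $ k) has_derivative (\<lambda>h. frechet_derivative (g c) (at (y t)) (h *\<^sub>R y') $ j $ k)) (at t)"
      using diff_chain_at[OF y[unfolded has_vector_derivative_def] entry_has_derivative[OF yV, of j k]]
      by (simp add: o_def)
    then show ?thesis
      by (simp add: has_field_derivative_def linear_cmul[OF lin] mult_commute_abs)
  qed
  have comp: "((\<lambda>s. f s $ j) has_real_derivative f' $ j) (at t)"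
    if "(f has_vector_derivative f') (at t)" for f :: "real \<Rightarrow> real ^ 'n" and f' j
    using bounded_linear.has_vector_derivative[OF bounded_linear_vec_nth that]
    by (simp add: has_real_derivative_iff_has_vector_derivative)
  have G': "?G' $ j $ k = (\<Sum>i\<in>UNIV. y' $ i * metric_deriv (y t) i j k)" for j k
  proof -
    have "?G' = frechet_derivative (g c) (at (y t)) (\<Sum>i\<in>UNIV. y' $ i *\<^sub>R axis i 1)"
      using basis_expansion[of y'] by (simp add: scalar_mult_eq_scaleR)
    also have "\<dots> = (\<Sum>i\<in>UNIV. y' $ i *\<^sub>R frechet_derivative (g c) (at (y t)) (axis i 1))"
      using lin by (simp add: linear_sum linear_cmul)
    finally show ?thesis by (simp add: metric_deriv_def)
  qed
  have "(\<Sum>j\<in>UNIV. \<Sum>k\<in>UNIV. v t $ j * ?G' $ j $ k * w t $ k) =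
      (\<Sum>j\<in>UNIV. \<Sum>k\<in>UNIV. \<Sum>i\<in>UNIV. \<Sum>m\<in>UNIV. ?C m i j * y' $ i * v t $ j * ?G $ m $ k * w t $ k) +
      (\<Sum>j\<in>UNIV. \<Sum>k\<in>UNIV. \<Sum>i\<in>UNIV. \<Sum>m\<in>UNIV. v t $ j * ?G $ j $ m * (?C m i k * y' $ i * w t $ k))"
    unfolding G' metric_compatible[OF yV]
    by (simp add: sum_distrib_left sum_distrib_right distrib_left distrib_right sum.distrib
        sym_entry[OF yV] ac_simps)
  moreover have "(\<Sum>j\<in>UNIV. \<Sum>k\<in>UNIV. \<Sum>i\<in>UNIV. \<Sum>m\<in>UNIV. ?C m i j * y' $ i * v t $ j * ?G $ m $ k * w t $ k)
      = \<Gamma> (v t) \<bullet> (?G *v w t)"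
  proof -
    have "\<Gamma> (v t) \<bullet> (?G *v w t) =
        (\<Sum>m\<in>UNIV. \<Sum>i\<in>UNIV. \<Sum>j\<in>UNIV. \<Sum>k\<in>UNIV. ?C m i j * y' $ i * v t $ j * ?G $ m $ k * w t $ k)"
      by (simp add: \<Gamma>_def inner_vec_def matrix_vector_mult_def sum_distrib_left sum_distrib_right ac_simps)
    also have "\<dots> = (\<Sum>j\<in>UNIV. \<Sum>k\<in>UNIV. \<Sum>i\<in>UNIV. \<Sum>m\<in>UNIV. ?C m i j * y' $ i * v t $ j * ?G $ m $ k * w t $ k)"
      by (rule trans[OF sum_move_inner4 sum_move_inner3])
    finally show ?thesis by simp
  qed
  moreover have "(\<Sum>j\<in>UNIV. \<Sum>k\<in>UNIV. \<Sum>i\<in>UNIV. \<Sum>m\<in>UNIV. v t $ j * ?G $ j $ m * (?C m i k * y' $ i * w t $ k))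
      = v t \<bullet> (?G *v \<Gamma> (w t))"
  proof -
    have "v t \<bullet> (?G *v \<Gamma> (w t)) =
        (\<Sum>j\<in>UNIV. \<Sum>m\<in>UNIV. \<Sum>i\<in>UNIV. \<Sum>k\<in>UNIV. v t $ j * ?G $ j $ m * (?C m i k * y' $ i * w t $ k))"
      by (simp add: \<Gamma>_def inner_vec_def matrix_vector_mult_def sum_distrib_left sum_distrib_right ac_simps)
    also have "\<dots> = (\<Sum>j\<in>UNIV. \<Sum>k\<in>UNIV. \<Sum>i\<in>UNIV. \<Sum>m\<in>UNIV. v t $ j * ?G $ j $ m * (?C m i k * y' $ i * w t $ k))"
      by (intro sum.cong[OF refl] trans[OF sum_move_inner3] sum.swap)
    finally show ?thesis by simp
  qed
  ultimately have key: "(\<Sum>j\<in>UNIV. \<Sum>k\<in>UNIV. v t $ j * ?G' $ j $ k * w t $ k) =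
      \<Gamma> (v t) \<bullet> (?G *v w t) + v t \<bullet> (?G *v \<Gamma> (w t))" by simp
  have "((\<lambda>s. \<Sum>j\<in>UNIV. \<Sum>k\<in>UNIV. v s $ j * g c (y s) $ j $ k * w s $ k) has_real_derivative
     (\<Sum>j\<in>UNIV. \<Sum>k\<in>UNIV. (v' $ j * ?G $ j $ k + ?G' $ j $ k * v t $ j) * w t $ k + w' $ k * (v t $ j * ?G $ j $ k))) (at t)"
    by (intro DERIV_sum DERIV_mult entry comp v w)
  moreover have "(\<Sum>j\<in>UNIV. \<Sum>k\<in>UNIV. (v' $ j * ?G $ j $ k + ?G' $ j $ k * v t $ j) * w t $ k + w' $ k * (v t $ j * ?G $ j $ k))
     = v' \<bullet> (?G *v w t) + v t \<bullet> (?G *v w') + (\<Sum>j\<in>UNIV. \<Sum>k\<in>UNIV. v t $ j * ?G' $ j $ k * w t $ k)"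
    by (simp add: inner_vec_def matrix_vector_mult_def sum.distrib sum_distrib_left algebra_simps)
  moreover have "(\<Sum>j\<in>UNIV. \<Sum>k\<in>UNIV. v s $ j * g c (y s) $ j $ k * w s $ k) = v s \<bullet> (g c (y s) *v w s)" for s
    by (simp add: inner_vec_def matrix_vector_mult_def sum_distrib_left mult.assoc)
  ultimately show ?thesis
    unfolding key by (simp add: inner_add_left inner_add_right matrix_vector_right_distrib algebra_simps)
qed

end

section \<open>Vector fields along the geodesic\<close>

locale geodesic_on_manifold =
  fixes A :: "('m::{t2_space,second_countable_topology}, 'n::finite) chart set"
    and g :: "('m, 'n) mtensor" and \<gamma> :: "real \<Rightarrow> 'm"
  assumes manifold: "riemannian_manifold A g" and geodesic: "geodesic A g \<gamma>"
begin

abbreviation inner_at :: "real \<Rightarrow> ('m, 'n) tvec \<Rightarrow> ('m, 'n) tvec \<Rightarrow> real" where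
  "inner_at t \<equiv> rinner A g (\<gamma> t)"

abbreviation (input) vel :: "real \<Rightarrow> ('m, 'n) tvec" where "vel \<equiv> velocity A \<gamma>"

abbreviation D :: "(real \<Rightarrow> ('m, 'n) tvec) \<Rightarrow> real \<Rightarrow> ('m, 'n) tvec" where
  "D \<equiv> cov_deriv A g \<gamma>"

abbreviation coord :: "('m, 'n) chart \<Rightarrow> real \<Rightarrow> real ^ 'n" where "coord c s \<equiv> snd c (\<gamma> s)"

text \<open>
  The chart in which the inner product at \<open>p\<close> is evaluated by its definition. Identities between
  inner products at one time are identities between components in this chart.
\<close>

definition chart_of :: "'m \<Rightarrow> ('m, 'n) chart" where "chart_of p = (SOME c. chart_at A p c)"

lemma atlas: "smooth_atlas A"
  using manifold by (simp add: riemannian_manifold_def)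

lemma chart_of: "chart_at A p (chart_of p)"
proof -
  have "p \<in> (\<Union>c\<in>A. fst c)" using atlas by (simp add: smooth_atlas_def)
  then have "\<exists>c. chart_at A p c" by (auto simp: chart_at_def)
  then show ?thesis unfolding chart_of_def by (rule someI_ex)
qed

lemma rinner_chart_of: "rinner A g p v w = v (chart_of p) \<bullet> (g (chart_of p) (snd (chart_of p) p) *v w (chart_of p))"
  by (simp add: rinner_def Let_def chart_of_def)

lemma chart_props:
  assumes "c \<in> A"
  shows "open (fst c)" "open (snd c ` fst c)" "homeomorphism (fst c) (snd c ` fst c) (snd c) (inv_into (fst c) (snd c))"
  using atlas assms unfolding smooth_atlas_def by (auto simp: case_prod_beta)

lemma coordinate_metric:
  assumes "c \<in> A" shows "coordinate_metric g c (snd c ` fst c)"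
proof
  show "open (snd c ` fst c)" using assms by (rule chart_props)
qed (use manifold assms in \<open>auto simp: riemannian_manifold_def\<close>)

lemma smooth_curve: "smooth_curve A \<gamma>" and cov_deriv_velocity: "D vel t = 0"
  using geodesic by (simp_all add: geodesic_def)

lemma open_times: "c \<in> A \<Longrightarrow> open {s. \<gamma> s \<in> fst c}"
  using smooth_curve chart_props(1)[of c] continuous_open_preimage[of UNIV \<gamma> "fst c"]
  by (simp add: smooth_curve_def vimage_def)

lemma transition_differentiable:
  assumes "chart_at A p c" "chart_at A p d"
  shows "transition c d differentiable (at (snd c p))"
proof -
  let ?W = "snd c ` (fst c \<inter> fst d)"
  have cd: "c \<in> A" "d \<in> A" "p \<in> fst c" "p \<in> fst d" using assms by (auto simp: chart_at_def)
  note h = chart_props(3)[OF cd(1)]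
  have "?W = snd c ` fst c \<inter> inv_into (fst c) (snd c) -` fst d"
    using h by (force simp: homeomorphism_def)
  also have "open \<dots>"
    using h chart_props[OF cd(1)] chart_props(1)[OF cd(2)]
    by (intro continuous_open_preimage) (auto simp: homeomorphism_def)
  finally have "open ?W" .
  moreover have "smooth_on ?W (transition c d)"
    using atlas cd by (auto simp: smooth_atlas_def)
  ultimately show ?thesis
    using smooth_on_has_derivative[of ?W "transition c d" "snd c p"] cd by (auto intro: differentiableI)
qed

lemma transition_linear:
  assumes "chart_at A p c" "chart_at A p d"
  shows "linear (frechet_derivative (transition c d) (at (snd c p)))"
  by (rule linear_frechet_derivative[OF transition_differentiable[OF assms]])

text \<open>
  The components in any other chart are the image of the components in \<open>c\<close> under a linear map.
\<close>

lemma tangent_eq_0: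
  assumes v: "v \<in> tangent_space A p" and c: "chart_at A p c" "v c = 0"
  shows "v = 0"
proof
  fix d
  show "v d = 0 d"
  proof (cases "chart_at A p d")
    case True
    then have "v d = frechet_derivative (transition c d) (at (snd c p)) (v c)"
      using v c unfolding tangent_space_def by blast
    then show ?thesis using c linear_0[OF transition_linear[OF c(1) True]] by simp
  next
    case False
    then have "v d = 0" using v unfolding tangent_space_def by blast
    then show ?thesis by simp
  qed
qed

lemma position_has_derivative:
  assumes "chart_at A (\<gamma> t) c"
  shows "(coord c has_vector_derivative vel t c) (at t)"
proof -
  have c: "c \<in> A" "\<gamma> t \<in> fst c" using assms by (auto simp: chart_at_def)
  have "smooth_on {s. \<gamma> s \<in> fst c} (coord c)"
    using smooth_curve c by (auto simp: smooth_curve_def)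
  from smooth_on_has_derivative[OF this open_times[OF c(1)], of t]
  have "coord c differentiable (at t)" using c by (auto intro: differentiableI)
  then show ?thesis using assms by (simp add: velocity_def vector_derivative_works)
qed

lemma velocity_tangent: "vel t \<in> tangent_space A (\<gamma> t)"
  unfolding tangent_space_def
proof (intro CollectI conjI allI impI)
  fix c d assume cd: "chart_at A (\<gamma> t) c \<and> chart_at A (\<gamma> t) d"
  then have c: "c \<in> A" "\<gamma> t \<in> fst c" and d: "d \<in> A" "\<gamma> t \<in> fst d" by (auto simp: chart_at_def)
  let ?T = "frechet_derivative (transition c d) (at (coord c t))"
  have T: "(transition c d has_derivative ?T) (at (coord c t))"
    using transition_differentiable cd frechet_derivative_works by blast
  from diff_chain_at[OF position_has_derivative[unfolded has_vector_derivative_def] this] cd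
  have "((\<lambda>s. transition c d (coord c s)) has_derivative (\<lambda>r. ?T (r *\<^sub>R vel t c))) (at t)"
    by (auto simp: o_def)
  then have "((\<lambda>s. transition c d (coord c s)) has_vector_derivative ?T (vel t c)) (at t)"
    by (simp add: has_vector_derivative_def linear_cmul[OF has_derivative_linear[OF T]])
  then have "(coord d has_vector_derivative ?T (vel t c)) (at t)"
  proof (rule has_vector_derivative_transform_within_open)
    show "open {s. \<gamma> s \<in> fst c}" "t \<in> {s. \<gamma> s \<in> fst c}" using open_times c by auto
    fix s assume "s \<in> {s. \<gamma> s \<in> fst c}"
    then show "transition c d (coord c s) = coord d s"
      using chart_props(3)[OF c(1)] by (simp add: transition_def homeomorphism_def)
  qed
  with position_has_derivative[of t d] cd show "vel t d = ?T (vel t c)"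
    by (blast intro: vector_derivative_unique_at)
qed (simp add: velocity_def)

lemma velocity_differentiable:
  assumes "chart_at A (\<gamma> t) c"
  shows "(\<lambda>s. vel s c) differentiable (at t)"
proof -
  let ?S = "{s. \<gamma> s \<in> fst c}"
  have c: "c \<in> A" "t \<in> ?S" using assms by (auto simp: chart_at_def)
  have sm: "smooth_on ?S (coord c)" using smooth_curve c by (auto simp: smooth_curve_def)
  show ?thesis
  proof (rule differentiable_transform_open[OF _ open_times[OF c(1)] c(2)])
    show "(\<lambda>s. frechet_derivative (coord c) (at s) 1) differentiable at t"
      by (rule smooth_on_derivative_differentiable[OF sm open_times[OF c(1)] c(2)])
    fix s assume s: "s \<in> ?S"
    then have "(coord c has_vector_derivative vel s c) (at s)"
      using c by (intro position_has_derivative) (auto simp: chart_at_def)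
    from frechet_derivative_at[OF this[unfolded has_vector_derivative_def], symmetric]
    show "frechet_derivative (coord c) (at s) 1 = vel s c" by simp
  qed
qed

lemma field_differentiable:
  assumes J: "smooth_field_along A \<gamma> J" and c: "chart_at A (\<gamma> t) c"
  shows "(\<lambda>s. J s c) differentiable (at t)"
    and "(\<lambda>s. vector_derivative (\<lambda>s. J s c) (at s)) differentiable (at t)"
proof -
  let ?S = "{s. \<gamma> s \<in> fst c}"
  have c': "c \<in> A" "t \<in> ?S" using c by (auto simp: chart_at_def)
  have sm: "smooth_on ?S (\<lambda>s. J s c)" using J c' by (simp add: smooth_field_along_def)
  have diff: "(\<lambda>s. J s c) differentiable (at s)" if "s \<in> ?S" for s
    by (rule differentiableI[OF smooth_on_has_derivative[OF sm open_times[OF c'(1)] that]])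
  then show "(\<lambda>s. J s c) differentiable (at t)" using c'(2) by blast
  show "(\<lambda>s. vector_derivative (\<lambda>s. J s c) (at s)) differentiable (at t)"
  proof (rule differentiable_transform_open[OF _ open_times[OF c'(1)] c'(2)])
    show "(\<lambda>s. frechet_derivative (\<lambda>s. J s c) (at s) 1) differentiable at t"
      by (rule smooth_on_derivative_differentiable[OF sm open_times[OF c'(1)] c'(2)])
    fix s assume s: "s \<in> ?S"
    show "frechet_derivative (\<lambda>s. J s c) (at s) 1 = vector_derivative (\<lambda>s. J s c) (at s)"
      by (simp add: frechet_derivative_eq_vector_derivative[OF diff[OF s]])
  qed
qed

lemma cov_deriv_differentiable:
  assumes J: "smooth_field_along A \<gamma> J" and c: "chart_at A (\<gamma> t) c"
  shows "(\<lambda>s. D J s c) differentiable (at t)"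
proof -
  let ?S = "{s. \<gamma> s \<in> fst c}"
  have c': "c \<in> A" "t \<in> ?S" using c by (auto simp: chart_at_def)
  interpret coordinate_metric g c "snd c ` fst c" by (rule coordinate_metric[OF c'(1)])
  have "(\<lambda>s. christoffel g c (coord c s) k i j) differentiable (at t)" for k i j
  proof -
    have "coord c differentiable (at t)"
      using position_has_derivative[OF c] by (auto simp: has_vector_derivative_def intro: differentiableI)
    from differentiable_chain_at[OF this differentiable_christoffel[of "coord c t" k i j]] c'
    show ?thesis by (auto simp: o_def)
  qed
  then have "(\<lambda>s. vector_derivative (\<lambda>s. J s c) (at s) +
       (\<chi> k. \<Sum>i\<in>UNIV. \<Sum>j\<in>UNIV. christoffel g c (coord c s) k i j * (vel s c $ i) * (J s c $ j))) differentiable (at t)"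
    by (intro differentiable_add field_differentiable[OF J c] differentiable_vec_lambda differentiable_sum ballI
        differentiable_mult differentiable_vec_nth velocity_differentiable[OF c]) auto
  then show ?thesis
    by (rule differentiable_transform_open[OF _ open_times[OF c'(1)] c'(2)])
      (use c' in \<open>auto simp: cov_deriv_def chart_at_def\<close>)
qed

lemma chart_inner_has_derivative:
  assumes c: "chart_at A (\<gamma> t) c"
    and J: "(\<lambda>s. J s c) differentiable (at t)" and K: "(\<lambda>s. K s c) differentiable (at t)"
  shows "((\<lambda>s. J s c \<bullet> (g c (coord c s) *v K s c)) has_real_derivative
    D J t c \<bullet> (g c (coord c t) *v K t c) + J t c \<bullet> (g c (coord c t) *v D K t c)) (at t)"
proof -
  have c': "c \<in> A" "\<gamma> t \<in> fst c" using c by (auto simp: chart_at_def)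
  interpret coordinate_metric g c "snd c ` fst c" by (rule coordinate_metric[OF c'(1)])
  show ?thesis
    using inner_along_curve_has_derivative[of "coord c" t, OF _ position_has_derivative[OF c]
        J[unfolded vector_derivative_works] K[unfolded vector_derivative_works]] c' c
    by (simp add: cov_deriv_def)
qed

lemma rinner_sym: "rinner A g p v w = rinner A g p w v"
proof -
  have c: "chart_of p \<in> A" "p \<in> fst (chart_of p)" using chart_of[of p] by (auto simp: chart_at_def)
  interpret coordinate_metric g "chart_of p" "snd (chart_of p) ` fst (chart_of p)" by (rule coordinate_metric[OF c(1)])
  show ?thesis unfolding rinner_chart_of using c by (intro inner_metric_sym) auto
qed

lemma rinner_linear:
  "rinner A g p (v + v') w = rinner A g p v w + rinner A g p v' w"
  "rinner A g p (r *\<^sub>R v) w = r * rinner A g p v w"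
  "rinner A g p v (w + w') = rinner A g p v w + rinner A g p v w'"
  "rinner A g p v (r *\<^sub>R w) = r * rinner A g p v w"
  by (simp_all add: rinner_chart_of inner_add_left inner_add_right matrix_vector_right_distrib
      matrix_vector_mult_scaleR)

lemma rinner_nonneg: "rinner A g p v v \<ge> 0"
  and rinner_pos: "v (chart_of p) \<noteq> 0 \<Longrightarrow> rinner A g p v v > 0"
proof -
  have c: "chart_of p \<in> A" "p \<in> fst (chart_of p)" using chart_of[of p] by (auto simp: chart_at_def)
  interpret coordinate_metric g "chart_of p" "snd (chart_of p) ` fst (chart_of p)" by (rule coordinate_metric[OF c(1)])
  show p: "v (chart_of p) \<noteq> 0 \<Longrightarrow> rinner A g p v v > 0"
    unfolding rinner_chart_of using c by (intro positive) auto
  then show "rinner A g p v v \<ge> 0"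
    by (cases "v (chart_of p) = 0") (auto simp: rinner_chart_of)
qed

lemma rnorm_squared: "(rnorm A g p v)\<^sup>2 = rinner A g p v v"
  by (simp add: rnorm_def rinner_nonneg)

lemma rinner_pos_tangent: "v \<in> tangent_space A p \<Longrightarrow> v \<noteq> 0 \<Longrightarrow> rinner A g p v v > 0"
  using rinner_pos tangent_eq_0[OF _ chart_of] by blast

text \<open>
  The inner product of tangent vectors has the same value in every chart, so it can be evaluated in
  the fixed chart \<open>c\<close> at all times near \<open>t\<close>, where the product rule applies to the components.
\<close>

lemma rinner_has_derivative:
  assumes JK: "\<And>s. J s \<in> tangent_space A (\<gamma> s)" "\<And>s. K s \<in> tangent_space A (\<gamma> s)"
    and c: "chart_at A (\<gamma> t) c"
    and diff: "(\<lambda>s. J s c) differentiable (at t)" "(\<lambda>s. K s c) differentiable (at t)"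
  shows "((\<lambda>s. inner_at s (J s) (K s)) has_real_derivative
    D J t c \<bullet> (g c (coord c t) *v K t c) + J t c \<bullet> (g c (coord c t) *v D K t c)) (at t)"
proof (rule has_field_derivative_transform_within_open[OF chart_inner_has_derivative[where J=J and K=K, OF c diff]])
  have c': "c \<in> A" "\<gamma> t \<in> fst c" using c by (auto simp: chart_at_def)
  then show "open {s. \<gamma> s \<in> fst c}" "t \<in> {s. \<gamma> s \<in> fst c}" using open_times by auto
  fix s assume "s \<in> {s. \<gamma> s \<in> fst c}"
  then show "J s c \<bullet> (g c (coord c s) *v K s c) = inner_at s (J s) (K s)"
    using rinner_eq[OF manifold JK, of s c] c' by (simp add: chart_at_def)
qed

lemma field_inner_has_derivative:
  assumes "smooth_field_along A \<gamma> J" "smooth_field_along A \<gamma> K"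
  shows "((\<lambda>s. inner_at s (J s) (K s)) has_real_derivative
    inner_at t (D J t) (K t) + inner_at t (J t) (D K t)) (at t)"
  using rinner_has_derivative[where J=J and K=K and t=t, OF _ _ chart_of
     field_differentiable(1)[OF assms(1) chart_of] field_differentiable(1)[OF assms(2) chart_of]] assms
  by (simp add: rinner_chart_of smooth_field_along_def)

text \<open>
  By symmetry \<open>\<langle>J', K\<rangle>\<close> is half the derivative of \<open>\<langle>J, K\<rangle>\<close>, and so it is given near \<open>t\<close> by the
  components in a single chart, where it can be differentiated once more. No transformation law for
  \<open>J'\<close> enters.
\<close>

lemma deriv_inner_has_derivative:
  assumes J: "smooth_field_along A \<gamma> J" and K: "smooth_field_along A \<gamma> K"
    and sym: "\<And>s. inner_at s (J s) (D K s) = inner_at s (D J s) (K s)"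
  shows "((\<lambda>s. inner_at s (D J s) (K s)) has_real_derivative
    (inner_at t (D (D J) t) (K t) + 2 * inner_at t (D J t) (D K t) + inner_at t (J t) (D (D K) t)) / 2) (at t)"
proof -
  define c where "c = chart_of (\<gamma> t)"
  have c: "chart_at A (\<gamma> t) c" "c \<in> A" "\<gamma> t \<in> fst c" using chart_of by (auto simp: c_def chart_at_def)
  have JK: "\<And>s. J s \<in> tangent_space A (\<gamma> s)" "\<And>s. K s \<in> tangent_space A (\<gamma> s)"
    using J K by (auto simp: smooth_field_along_def)
  let ?S = "{s. \<gamma> s \<in> fst c}"
  have eq: "(D J s c \<bullet> (g c (coord c s) *v K s c) + J s c \<bullet> (g c (coord c s) *v D K s c)) / 2 = inner_at s (D J s) (K s)"
    if "s \<in> ?S" for s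
  proof -
    have cs: "chart_at A (\<gamma> s) c" using that c by (simp add: chart_at_def)
    from DERIV_unique[OF field_inner_has_derivative[OF J K]
        rinner_has_derivative[OF JK cs field_differentiable(1)[OF J cs] field_differentiable(1)[OF K cs]]]
    show ?thesis using sym[of s] by simp
  qed
  have "((\<lambda>s. (D J s c \<bullet> (g c (coord c s) *v K s c) + J s c \<bullet> (g c (coord c s) *v D K s c)) / 2) has_real_derivative
     ((D (D J) t c \<bullet> (g c (coord c t) *v K t c) + D J t c \<bullet> (g c (coord c t) *v D K t c)) +
     (D J t c \<bullet> (g c (coord c t) *v D K t c) + J t c \<bullet> (g c (coord c t) *v D (D K) t c))) / 2) (at t)"
    by (intro DERIV_cdivide DERIV_add chart_inner_has_derivative c field_differentiable J K cov_deriv_differentiable)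
  then have "((\<lambda>s. inner_at s (D J s) (K s)) has_real_derivative
     ((D (D J) t c \<bullet> (g c (coord c t) *v K t c) + D J t c \<bullet> (g c (coord c t) *v D K t c)) +
     (D J t c \<bullet> (g c (coord c t) *v D K t c) + J t c \<bullet> (g c (coord c t) *v D (D K) t c))) / 2) (at t)"
    by (rule has_field_derivative_transform_within_open[OF _ open_times[OF c(2)]]) (use c eq in auto)
  then show ?thesis by (simp add: rinner_chart_of c_def algebra_simps)
qed

lemma cov_deriv_add:
  assumes "smooth_field_along A \<gamma> J" "smooth_field_along A \<gamma> K"
  shows "D (J + K) t = D J t + D K t"
proof
  fix c show "D (J + K) t c = (D J t + D K t) c"
  proof (cases "chart_at A (\<gamma> t) c")
    case True
    then show ?thesis
      using field_differentiable(1)[OF assms(1) True] field_differentiable(1)[OF assms(2) True]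
      by (simp add: cov_deriv_def vector_derivative_add_at vec_eq_iff distrib_left sum.distrib)
  qed (simp add: cov_deriv_def)
qed

lemma cov_deriv_scaleR:
  assumes "smooth_field_along A \<gamma> J"
  shows "D (r *\<^sub>R J) t = r *\<^sub>R D J t"
proof
  fix c show "D (r *\<^sub>R J) t c = (r *\<^sub>R D J t) c"
  proof (cases "chart_at A (\<gamma> t) c")
    case True
    then show ?thesis
      using field_differentiable(1)[OF assms(1) True]
      by (simp add: cov_deriv_def vector_derivative_scaleR_at vec_eq_iff distrib_left sum_distrib_left ac_simps)
  qed (simp add: cov_deriv_def)
qed

lemma normal_jacobiD:
  assumes "J \<in> normal_jacobi_fields A g \<gamma>"
  shows "smooth_field_along A \<gamma> J" "J t \<in> tangent_space A (\<gamma> t)" "inner_at t (J t) (vel t) = 0"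
    "D (D J) t = - curvature A g (\<gamma> t) (J t) (vel t) (vel t)"
  using assms by (auto simp: normal_jacobi_fields_def jacobi_field_def smooth_field_along_def eq_neg_iff_add_eq_0)

text \<open>
  The velocity of a geodesic is parallel, so the derivative of \<open>\<langle>J, v\<rangle> = 0\<close> consists of this term
  alone.
\<close>

lemma cov_deriv_normal:
  assumes J: "J \<in> normal_jacobi_fields A g \<gamma>"
  shows "inner_at t (D J t) (vel t) = 0"
proof -
  let ?c = "chart_of (\<gamma> t)"
  have "((\<lambda>s. inner_at s (J s) (vel s)) has_real_derivative
     D J t ?c \<bullet> (g ?c (coord ?c t) *v vel t ?c) + J t ?c \<bullet> (g ?c (coord ?c t) *v D vel t ?c)) (at t)"
    by (rule rinner_has_derivative[OF normal_jacobiD(2)[OF J] velocity_tangent chart_of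
        field_differentiable(1)[OF normal_jacobiD(1)[OF J] chart_of] velocity_differentiable[OF chart_of]])
  then have "((\<lambda>s. inner_at s (J s) (vel s)) has_real_derivative
     inner_at t (D J t) (vel t) + inner_at t (J t) (D vel t)) (at t)"
    by (simp only: rinner_chart_of)
  moreover have "inner_at t (J t) (D vel t) = 0" by (simp add: cov_deriv_velocity rinner_chart_of)
  ultimately have "((\<lambda>s. 0) has_real_derivative inner_at t (D J t) (vel t)) (at t)"
    by (simp add: normal_jacobiD(3)[OF J])
  then show ?thesis using DERIV_const DERIV_unique by blast
qed

lemma rinner_curvature_swap:
  "rinner A g p (curvature A g p X Y Y) X = rinner A g p (curvature A g p Y X X) Y"
proof -
  have c: "chart_at A p (chart_of p)" "chart_of p \<in> A" "p \<in> fst (chart_of p)" using chart_of[of p] by (auto simp: chart_at_def)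
  interpret coordinate_metric g "chart_of p" "snd (chart_of p) ` fst (chart_of p)" by (rule coordinate_metric[OF c(2)])
  show ?thesis
    using curvature_inner_swap[of "snd (chart_of p) p" "X (chart_of p)" "Y (chart_of p)"] c
    by (simp add: rinner_chart_of curvature_def)
qed

text \<open>
  If \<open>w\<close> is nonzero, it spans a plane with the velocity; since the velocity is a unit vector
  orthogonal to \<open>w\<close>, the area factor in the sectional curvature is \<open>|w|\<^sup>2\<close>.
\<close>

lemma curvature_lower_bound:
  assumes unit: "unit_speed A g \<gamma>" and sec: "sec_along_ge A g \<gamma> \<kappa>"
    and w: "w \<in> tangent_space A (\<gamma> t)" "inner_at t w (vel t) = 0"
  shows "inner_at t (curvature A g (\<gamma> t) w (vel t) (vel t)) w \<ge> \<kappa> * inner_at t w w"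
proof (cases "w = 0")
  case True
  then show ?thesis by (simp add: rinner_chart_of)
next
  case False
  have vv: "inner_at t (vel t) (vel t) = 1"
    using unit rnorm_squared[of "\<gamma> t" "vel t"] by (simp add: unit_speed_def)
  have "vel t \<notin> span {w}"
  proof
    assume "vel t \<in> span {w}"
    then obtain k where "vel t = k *\<^sub>R w" by (auto simp: span_singleton)
    then have "inner_at t (vel t) (vel t) = k * inner_at t w (vel t)" by (metis rinner_linear(2))
    then show False using vv w by simp
  qed
  then have ind: "independent {vel t, w}"
    using False by (simp add: independent_insert)
  moreover have "vel t \<noteq> w" using vv w(2) by auto
  ultimately have "sectional_curvature A g (\<gamma> t) (vel t) w \<ge> \<kappa>"
    using sec w by (simp add: sec_along_ge_def)
  then show ?thesis
    using rinner_pos_tangent[OF w(1) False] vv w(2) rinner_sym[of "\<gamma> t" "vel t" w]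
    by (simp add: sectional_curvature_def rinner_curvature_swap[of _ "w"] pos_le_divide_eq)
qed

end

section \<open>Lagrangian families of Jacobi fields\<close>

locale lagrangian_family = geodesic_on_manifold A g \<gamma>
  for A :: "('m::{t2_space,second_countable_topology}, 'n::finite) chart set"
    and g :: "('m, 'n) mtensor" and \<gamma> :: "real \<Rightarrow> 'm" +
  fixes \<kappa> :: real and \<Lambda> :: "(real \<Rightarrow> ('m, 'n) tvec) set"
  assumes unit: "unit_speed A g \<gamma>" and sec: "sec_along_ge A g \<gamma> \<kappa>"
    and lagrangian: "lagrangian A g \<gamma> \<Lambda>"
begin

lemma subspace: "subspace \<Lambda>" and normal: "J \<in> \<Lambda> \<Longrightarrow> J \<in> normal_jacobi_fields A g \<gamma>"
  and dim: "dim \<Lambda> = CARD('n) - 1"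
  and symmetric: "J \<in> \<Lambda> \<Longrightarrow> K \<in> \<Lambda> \<Longrightarrow> inner_at t (J t) (D K t) = inner_at t (D J t) (K t)"
  using lagrangian by (auto simp: lagrangian_def)

lemmas smooth = normal_jacobiD(1)[OF normal]
lemmas tangent = normal_jacobiD(2)[OF normal]

text \<open>
  At a nonsingular time evaluation is injective on \<open>\<Lambda>\<close>, so its image is an \<open>(n - 1)\<close>-dimensional subspace of the
  normal space, which is a hyperplane.
\<close>

lemma nonsingular_values:
  assumes ns: "\<not> singularity \<Lambda> t" and c: "chart_at A (\<gamma> t) c"
    and w: "w \<bullet> (g c (coord c t) *v vel t c) = 0"
  shows "\<exists>K\<in>\<Lambda>. K t c = w"
proof -
  have c': "c \<in> A" "\<gamma> t \<in> fst c" using c by (auto simp: chart_at_def)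
  define u where "u = g c (coord c t) *v vel t c"
  have "inner_at t (vel t) (vel t) = 1"
    using unit rnorm_squared[of "\<gamma> t" "vel t"] by (simp add: unit_speed_def)
  then have u0: "u \<noteq> 0"
    using rinner_eq[OF manifold velocity_tangent velocity_tangent c] by (auto simp: u_def)
  define T where "T = (\<lambda>K::real \<Rightarrow> ('m, 'n) tvec. K t c)"
  have lin: "linear T" by (rule linearI) (simp_all add: T_def)
  have "K = 0" if "K \<in> \<Lambda>" "T K = 0" for K
    using tangent_eq_0[OF tangent[OF that(1)] c] that ns by (auto simp: singularity_def T_def)
  then have inj: "inj_on T \<Lambda>"
    using linear_injective_on_subspace_0[OF lin subspace] by blast
  obtain B where B: "B \<subseteq> \<Lambda>" "independent B" "\<Lambda> \<subseteq> span B" "card B = dim \<Lambda>"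
    using basis_exists by blast
  have spanB: "span B = \<Lambda>" using B span_subspace subspace by blast
  have indT: "independent (T ` B)"
    using linear_independent_injective_image[OF lin B(2)] inj spanB by simp
  have cardT: "card (T ` B) = CARD('n) - 1"
    using card_image[OF inj_on_subset[OF inj B(1)]] B(4) dim by simp
  have sub: "T ` B \<subseteq> {x. u \<bullet> x = 0}"
  proof clarify
    fix K assume "K \<in> B"
    then have K: "K \<in> \<Lambda>" using B by auto
    show "u \<bullet> T K = 0"
      using normal_jacobiD(3)[OF normal[OF K], of t] rinner_eq[OF manifold tangent[OF K] velocity_tangent c]
      by (simp add: u_def T_def inner_commute)
  qed
  have "dim {x. u \<bullet> x = 0} = CARD('n) - 1" using dim_hyperplane[OF u0] by simp
  then have "{x. u \<bullet> x = 0} \<subseteq> span (T ` B)"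
    using card_ge_dim_independent[OF sub indT] cardT by simp
  moreover have "w \<in> {x. u \<bullet> x = 0}" using w by (simp add: u_def inner_commute)
  ultimately have "w \<in> T ` \<Lambda>" using linear_span_image[OF lin, of B] spanB by auto
  then show ?thesis by (auto simp: T_def)
qed

text \<open>
  The vector \<open>J' - r J\<close> is normal and orthogonal to all values of \<open>\<Lambda>\<close>. These fill the normal space,
  so the vector is orthogonal to itself.
\<close>

lemma eigenvector:
  assumes ns: "\<not> singularity \<Lambda> t" and J: "J \<in> \<Lambda>"
    and crit: "\<And>K. K \<in> \<Lambda> \<Longrightarrow> inner_at t (D J t) (K t) = r * inner_at t (J t) (K t)"
  shows "D J t (chart_of (\<gamma> t)) = r *\<^sub>R J t (chart_of (\<gamma> t))"
proof -
  let ?c = "chart_of (\<gamma> t)"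
  define W where "W = D J t + (- r) *\<^sub>R J t"
  have "inner_at t W (vel t) = 0"
    using cov_deriv_normal[OF normal[OF J]] normal_jacobiD(3)[OF normal[OF J]]
    by (simp add: W_def rinner_linear(1,2) del: scaleR_minus_left)
  then obtain K where K: "K \<in> \<Lambda>" "K t ?c = W ?c"
    using nonsingular_values[OF ns chart_of, of "W ?c"] by (auto simp: rinner_chart_of)
  have "inner_at t W W = inner_at t W (K t)" using K(2) by (simp add: rinner_chart_of)
  also have "\<dots> = 0"
    using crit[OF K(1)] by (simp add: W_def rinner_linear(1,2) del: scaleR_minus_left)
  finally have "W ?c = 0" using rinner_pos[of W "\<gamma> t"] by fastforce
  then show ?thesis by (simp add: W_def)
qed

text \<open>
  By the Jacobi equation \<open>\<langle>J', J\<rangle>' = |J'|\<^sup>2 - \<langle>R(J, v)v, J\<rangle>\<close>. With \<open>J' = r J\<close> the quotient rule gives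
  \<open>r\<^sup>2 - \<langle>R(J, v)v, J\<rangle> / |J|\<^sup>2 - 2 r\<^sup>2\<close>.
\<close>

lemma rayleigh_derivative:
  assumes ns: "\<not> singularity \<Lambda> t" and J: "J \<in> \<Lambda>" "J \<noteq> 0"
    and crit: "\<And>K. K \<in> \<Lambda> \<Longrightarrow> inner_at t (D J t) (K t) = r * inner_at t (J t) (K t)"
  shows "\<exists>d\<le>- r\<^sup>2 - \<kappa>. ((\<lambda>s. inner_at s (D J s) (J s) / inner_at s (J s) (J s)) has_real_derivative d) (at t)"
proof -
  have "J t \<noteq> 0" using ns J by (auto simp: singularity_def)
  then have P: "inner_at t (J t) (J t) > 0" by (intro rinner_pos_tangent tangent J)
  let ?R = "inner_at t (curvature A g (\<gamma> t) (J t) (vel t) (vel t)) (J t)"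
  have "inner_at t (D (D J) t) (J t) = - ?R"
    unfolding normal_jacobiD(4)[OF normal[OF J(1)]] by (simp add: rinner_chart_of)
  then have "((\<lambda>s. inner_at s (D J s) (J s)) has_real_derivative inner_at t (D J t) (D J t) - ?R) (at t)"
    using deriv_inner_has_derivative[where J=J and K=J and t=t, OF smooth smooth symmetric] J rinner_sym[of "\<gamma> t" "J t" "D (D J) t"]
    by (simp add: diff_divide_distrib)
  moreover have "D J t (chart_of (\<gamma> t)) = r *\<^sub>R J t (chart_of (\<gamma> t))"
    by (rule eigenvector[OF ns J(1)]) (rule crit)
  then have "inner_at t (D J t) (D J t) = r\<^sup>2 * inner_at t (J t) (J t)"
    by (simp add: rinner_chart_of matrix_vector_mult_scaleR power2_eq_square)
  ultimately have N: "((\<lambda>s. inner_at s (D J s) (J s)) has_real_derivative r\<^sup>2 * inner_at t (J t) (J t) - ?R) (at t)"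
    by simp
  have P': "((\<lambda>s. inner_at s (J s) (J s)) has_real_derivative 2 * (r * inner_at t (J t) (J t))) (at t)"
    using field_inner_has_derivative[where J=J and K=J and t=t, OF smooth smooth] J crit[OF J(1)] symmetric[OF J(1) J(1)] by simp
  have quotient: "((r\<^sup>2 * p - q) * p - r * p * (2 * (r * p))) / (p * p) = - r\<^sup>2 - q / p"
    if "p \<noteq> 0" for p q :: real
    using that by (simp add: field_simps power2_eq_square)
  have "((\<lambda>s. inner_at s (D J s) (J s) / inner_at s (J s) (J s)) has_real_derivative
     - r\<^sup>2 - ?R / inner_at t (J t) (J t)) (at t)"
    using DERIV_divide[OF N P'] P quotient[of "inner_at t (J t) (J t)" ?R] crit[OF J(1)] by simp
  moreover have "?R / inner_at t (J t) (J t) \<ge> \<kappa>"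
    using curvature_lower_bound[OF unit sec tangent[OF J(1)] normal_jacobiD(3)[OF normal[OF J(1)]]] P
    by (simp add: pos_le_divide_eq)
  ultimately show ?thesis by (intro exI[of _ "- r\<^sup>2 - ?R / inner_at t (J t) (J t)"]) auto
qed

text \<open>
  Evaluation in a chart at the nonsingular time \<open>b\<close> identifies \<open>\<Lambda>\<close> with a subspace of a Euclidean
  space, which makes compactness available. The inverse is extended linearly to the whole space,
  so that the forms below are bilinear without restriction of their arguments.
\<close>

lemma coordinates:
  assumes ns: "\<not> singularity \<Lambda> b"
  shows "\<exists>(E :: (real ^ 'n) set) (\<Psi> :: real ^ 'n \<Rightarrow> real \<Rightarrow> ('m, 'n) tvec).
    subspace E \<and> linear \<Psi> \<and> range \<Psi> \<subseteq> \<Lambda> \<and> \<Psi> ` E = \<Lambda> \<and> (\<forall>x\<in>E. x \<noteq> 0 \<longrightarrow> \<Psi> x \<noteq> 0)"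
proof -
  define T where "T = (\<lambda>K::real \<Rightarrow> ('m, 'n) tvec. K b (chart_of (\<gamma> b)))"
  have lin: "linear T" by (rule linearI) (simp_all add: T_def)
  have "K = 0" if "K \<in> \<Lambda>" "T K = 0" for K
    using tangent_eq_0[OF tangent[OF that(1)] chart_of] that ns by (auto simp: singularity_def T_def)
  then have inj: "inj_on T \<Lambda>"
    using linear_injective_on_subspace_0[OF lin subspace] by blast
  obtain \<Psi> where \<Psi>: "range \<Psi> \<subseteq> \<Lambda>" "linear \<Psi>" "\<And>K. K \<in> \<Lambda> \<Longrightarrow> \<Psi> (T K) = K"
    using linear_exists_left_inverse_on[OF lin subspace inj] by blast
  have "subspace (T ` \<Lambda>)" by (rule linear_subspace_image[OF lin subspace])
  moreover have "\<Psi> ` T ` \<Lambda> = \<Lambda>" using \<Psi>(3) by force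
  moreover have "\<Psi> x \<noteq> 0" if "x \<in> T ` \<Lambda>" "x \<noteq> 0" for x
    using that \<Psi>(3) linear_0[OF lin] by auto
  ultimately show ?thesis using \<Psi>(1,2) by blast
qed

context
  fixes \<Psi> :: "real ^ 'n \<Rightarrow> real \<Rightarrow> ('m, 'n) tvec"
  assumes lin: "linear \<Psi>" and range: "\<And>x. \<Psi> x \<in> \<Lambda>"
begin

lemma bilinear_inner: "bilinear (\<lambda>x y. inner_at t (\<Psi> x t) (\<Psi> y t))"
  unfolding bilinear_def
  by (auto intro!: linearI simp: linear_add[OF lin] linear_cmul[OF lin] rinner_linear)

lemma bilinear_deriv_inner: "bilinear (\<lambda>x y. inner_at t (D (\<Psi> x) t) (\<Psi> y t))"
  unfolding bilinear_def
  by (auto intro!: linearI simp: linear_add[OF lin] linear_cmul[OF lin] rinner_linear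
      cov_deriv_add[OF smooth smooth] cov_deriv_scaleR[OF smooth] range)

lemma continuous_inner: "continuous_on S (\<lambda>t. inner_at t (\<Psi> x t) (\<Psi> y t))"
  by (rule DERIV_continuous_on, rule has_field_derivative_at_within,
      rule field_inner_has_derivative[OF smooth[OF range] smooth[OF range]])

lemma continuous_deriv_inner: "continuous_on S (\<lambda>t. inner_at t (D (\<Psi> x) t) (\<Psi> y t))"
  by (rule DERIV_continuous_on, rule has_field_derivative_at_within,
      rule deriv_inner_has_derivative[OF smooth[OF range] smooth[OF range] symmetric[OF range range]])

lemma deriv_inner_sym: "inner_at t (D (\<Psi> x) t) (\<Psi> y t) = inner_at t (D (\<Psi> y) t) (\<Psi> x t)"
  using symmetric[OF range range, of t y x] rinner_sym by metis

end

lemma inner_pos: "J \<in> \<Lambda> \<Longrightarrow> J t \<noteq> 0 \<Longrightarrow> inner_at t (J t) (J t) > 0"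
  by (intro rinner_pos_tangent tangent)

lemma comparison:
  assumes t01: "t0 < t1" and ns: "\<And>t. t \<in> {t0<..t1} \<Longrightarrow> \<not> singularity \<Lambda> t"
    and J0: "J0 \<in> \<Lambda>" "J0 t0 \<noteq> 0"
    and l: "\<And>t. t \<in> {t0..t1} \<Longrightarrow> (l has_real_derivative - (l t)\<^sup>2 - \<kappa>) (at t within {t0..t1})"
    and init: "inner_at t0 (D J0 t0) (J0 t0) \<le> l t0 * inner_at t0 (J0 t0) (J0 t0)"
  shows "\<exists>J\<in>\<Lambda> - {0}. inner_at t1 (D J t1) (J t1) \<le> l t1 * inner_at t1 (J t1) (J t1)"
proof -
  have end_ns: "\<not> singularity \<Lambda> t1" using ns t01 by simp
  obtain E :: "(real ^ 'n) set" and \<Psi> :: "real ^ 'n \<Rightarrow> real \<Rightarrow> ('m, 'n) tvec" where E: "subspace E" "linear \<Psi>" "range \<Psi> \<subseteq> \<Lambda>" "\<Psi> ` E = \<Lambda>" "\<forall>x\<in>E. x \<noteq> 0 \<longrightarrow> \<Psi> x \<noteq> 0"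
    using coordinates[OF end_ns] by blast
  then have \<Psi>: "\<Psi> x \<in> \<Lambda>" "x \<in> E \<Longrightarrow> x \<noteq> 0 \<Longrightarrow> \<Psi> x \<noteq> 0" for x by auto
  obtain x0 where x0: "x0 \<in> E" "\<Psi> x0 = J0" using E(4) J0(1) by auto
  let ?N = "\<lambda>t x y. inner_at t (D (\<Psi> x) t) (\<Psi> y t)" and ?P = "\<lambda>t x y. inner_at t (\<Psi> x t) (\<Psi> y t)"
  have "\<exists>x\<in>E - {0}. ?N t1 x x \<le> l t1 * ?P t1 x x"
  proof (rule rayleigh_quotient_riccati_comparison[of t0 t1 E ?N ?P \<kappa> l x0])
    show "0 < ?P t x x" if "t \<in> {t0<..t1}" "x \<in> E" "x \<noteq> 0" for t x
      using ns[OF that(1)] \<Psi>(1) \<Psi>(2)[OF that(2,3)] by (intro inner_pos) (auto simp: singularity_def)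
    show "\<exists>d\<le>- r\<^sup>2 - \<kappa>. ((\<lambda>s. ?N s x x / ?P s x x) has_real_derivative d) (at t)"
      if "t \<in> {t0<..<t1}" "x \<in> E" "x \<noteq> 0" "\<And>y. y \<in> E \<Longrightarrow> ?N t x y = r * ?P t x y" for t x r
      using that E(4) \<Psi>(1) ns[of t] by (intro rayleigh_derivative \<Psi>(2)) auto
  qed (use t01 E(1,2) \<Psi>(1) l init J0 x0 in \<open>auto intro: bilinear_inner bilinear_deriv_inner continuous_inner
      continuous_deriv_inner deriv_inner_sym rinner_sym inner_pos\<close>)
  then show ?thesis using \<Psi> by blast
qed

lemma deriv_inner_bounded_below:
  assumes ab: "a \<le> b" and ns: "\<And>t. t \<in> {a..b} \<Longrightarrow> \<not> singularity \<Lambda> t"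
  shows "\<exists>m. \<forall>t\<in>{a..b}. \<forall>J\<in>\<Lambda>. m * inner_at t (J t) (J t) \<le> inner_at t (D J t) (J t)"
proof -
  have end_ns: "\<not> singularity \<Lambda> b" using ns ab by simp
  obtain E :: "(real ^ 'n) set" and \<Psi> :: "real ^ 'n \<Rightarrow> real \<Rightarrow> ('m, 'n) tvec" where E: "subspace E" "linear \<Psi>" "range \<Psi> \<subseteq> \<Lambda>" "\<Psi> ` E = \<Lambda>" "\<forall>x\<in>E. x \<noteq> 0 \<longrightarrow> \<Psi> x \<noteq> 0"
    using coordinates[OF end_ns] by blast
  then have \<Psi>: "\<Psi> x \<in> \<Lambda>" "x \<in> E \<Longrightarrow> x \<noteq> 0 \<Longrightarrow> \<Psi> x \<noteq> 0" for x by auto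
  let ?N = "\<lambda>t x y. inner_at t (D (\<Psi> x) t) (\<Psi> y t)" and ?P = "\<lambda>t x y. inner_at t (\<Psi> x t) (\<Psi> y t)"
  have "\<exists>m. \<forall>t\<in>{a..b}. \<forall>x\<in>E. m * ?P t x x \<le> ?N t x x"
  proof (rule rayleigh_quotient_bounded_below[of E ?N ?P a b])
    show "0 < ?P t x x" if "t \<in> {a..b}" "x \<in> E" "x \<noteq> 0" for t x
      using ns[OF that(1)] \<Psi>(1) \<Psi>(2)[OF that(2,3)] by (intro inner_pos) (auto simp: singularity_def)
  qed (use E(1,2) \<Psi>(1) in \<open>auto intro: bilinear_inner bilinear_deriv_inner continuous_inner continuous_deriv_inner\<close>)
  then show ?thesis unfolding E(4)[symmetric] by blast
qed

text \<open>
  Nonsingularity at \<open>T\<close> itself would bound all quotients below near \<open>T\<close>, whereas the comparison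
  produces fields whose quotient is at most \<open>l\<close>, which tends to \<open>-\<infinity>\<close>.
\<close>

lemma singularity_before_pole:
  assumes t0: "t0 < T" and J0: "J0 \<in> \<Lambda>" "J0 t0 \<noteq> 0"
    and l: "\<And>t. t \<in> {t0..<T} \<Longrightarrow> (l has_real_derivative - (l t)\<^sup>2 - \<kappa>) (at t)"
    and pole: "filterlim l at_bot (at_left T)"
    and init: "inner_at t0 (D J0 t0) (J0 t0) \<le> l t0 * inner_at t0 (J0 t0) (J0 t0)"
  shows "\<exists>t\<in>{t0<..T}. singularity \<Lambda> t"
proof (rule ccontr)
  assume "\<not> ?thesis"
  then have ns: "\<And>t. t \<in> {t0<..T} \<Longrightarrow> \<not> singularity \<Lambda> t" by blast
  define a where "a = (t0 + T) / 2"
  have a: "t0 < a" "a < T" using t0 by (auto simp: a_def)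
  obtain m where m: "\<And>t J. t \<in> {a..T} \<Longrightarrow> J \<in> \<Lambda> \<Longrightarrow> m * inner_at t (J t) (J t) \<le> inner_at t (D J t) (J t)"
    using deriv_inner_bounded_below[of a T] ns a by force
  have "eventually (\<lambda>t. l t < m) (at_left T)"
    using pole by (simp add: filterlim_at_bot_dense)
  moreover have "eventually (\<lambda>t. t \<in> {a<..<T}) (at_left T)"
    using a by (intro eventually_at_leftI[of a]) auto
  ultimately have "\<exists>t. l t < m \<and> t \<in> {a<..<T}"
    by (intro eventually_happens'[of "at_left T"] eventually_conj) auto
  then obtain t where t: "l t < m" "t \<in> {a<..<T}" by blast
  have "(l has_real_derivative - (l s)\<^sup>2 - \<kappa>) (at s within {t0..t})" if "s \<in> {t0..t}" for s
    by (rule has_field_derivative_at_within, rule l) (use that t in auto)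
  then have "\<exists>J\<in>\<Lambda> - {0}. inner_at t (D J t) (J t) \<le> l t * inner_at t (J t) (J t)"
    using ns t a J0 init by (intro comparison[of t0 t J0 l]) auto
  then obtain J where J: "J \<in> \<Lambda>" "J \<noteq> 0" "inner_at t (D J t) (J t) \<le> l t * inner_at t (J t) (J t)"
    by blast
  have "inner_at t (J t) (J t) > 0"
    using ns[of t] t a J by (intro inner_pos) (auto simp: singularity_def)
  then have "l t * inner_at t (J t) (J t) < m * inner_at t (J t) (J t)" using t by simp
  also have "\<dots> \<le> l t * inner_at t (J t) (J t)"
    using m[of t J] J t by force
  finally show False by simp
qed

end

section \<open>The comparison theorem and the cotangent\<close>

lemma cot_riccati:
  assumes "sin (t + \<alpha>) \<noteq> 0"
  shows "((\<lambda>t. cot (t + \<alpha>)) has_real_derivative - (cot (t + \<alpha>))\<^sup>2 - 1) (at t)"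
proof -
  have "((\<lambda>t. cot (t + \<alpha>)) has_real_derivative - inverse ((sin (t + \<alpha>))\<^sup>2)) (at t)"
    using DERIV_cot[OF assms] by (simp add: DERIV_shift)
  moreover have "- inverse ((sin (t + \<alpha>))\<^sup>2) = - (cot (t + \<alpha>))\<^sup>2 - 1"
    using assms sin_cos_squared_add[of "t + \<alpha>"] by (simp add: cot_def field_simps)
  ultimately show ?thesis by simp
qed

lemma cot_pole: "filterlim (\<lambda>t::real. cot (t + \<alpha>)) at_bot (at_left (pi - \<alpha>))"
proof -
  have "((\<lambda>t. pi / 2 - (t + \<alpha>)) \<longlongrightarrow> pi / 2 - (pi - \<alpha> + \<alpha>)) (at_left (pi - \<alpha>))"
    by (intro tendsto_intros)
  then have "filterlim (\<lambda>t. pi / 2 - (t + \<alpha>)) (at_right (- (pi / 2))) (at_left (pi - \<alpha>))"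
    unfolding filterlim_at by (auto simp: eventually_at_filter field_simps)
  from filterlim_compose[OF filterlim_tan_at_right this]
  show ?thesis by (simp add: tan_cot')
qed

theorem lemma5:
  fixes A :: "('m::{t2_space,second_countable_topology}, 'n::finite) chart set"
    and g :: "('m, 'n) mtensor"
    and \<gamma> :: "real \<Rightarrow> 'm"
    and \<kappa> :: real
    and J\<^sub>0 :: "real \<Rightarrow> ('m, 'n) tvec"
    and \<Lambda> :: "(real \<Rightarrow> ('m, 'n) tvec) set"
    and S :: "(real \<Rightarrow> ('m, 'n) tvec) \<Rightarrow> real \<Rightarrow> ('m, 'n) tvec"
  assumes "\<kappa> \<in> {-1, 0, 1}"
    and "complete_riemannian_manifold A g"
    and "geodesic A g \<gamma>" and "unit_speed A g \<gamma>"
    and "sec_along_ge A g \<gamma> \<kappa>"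
    and "J\<^sub>0 \<in> normal_jacobi_fields A g \<gamma>" and "J\<^sub>0 \<noteq> 0"
    and "lagrangian A g \<gamma> \<Lambda>" and "S = riccati_operator A g \<gamma> \<Lambda>" and "J\<^sub>0 \<in> \<Lambda>"
  shows
    "(\<forall>t\<^sub>0 t_max. \<forall>l :: real \<Rightarrow> real.
        t\<^sub>0 < t_max \<and> J\<^sub>0 t\<^sub>0 \<noteq> 0 \<and> (\<forall>t\<in>{t\<^sub>0<..<t_max}. \<not> singularity \<Lambda> t) \<and>
        (\<forall>t\<in>{t\<^sub>0..<t_max}. \<exists>l'. (l has_real_derivative l') (at t within {t\<^sub>0..<t_max}) \<and>
                          l' + (l t)\<^sup>2 + \<kappa> = 0) \<and>
        rinner A g (\<gamma> t\<^sub>0) (S J\<^sub>0 t\<^sub>0) (J\<^sub>0 t\<^sub>0) \<le> l t\<^sub>0 * (rnorm A g (\<gamma> t\<^sub>0) (J\<^sub>0 t\<^sub>0))\<^sup>2 \<longrightarrow>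
        (\<forall>t\<^sub>1\<in>{t\<^sub>0..<t_max}. \<exists>J\<^sub>1\<in>\<Lambda> - {0}.
           rinner A g (\<gamma> t\<^sub>1) (S J\<^sub>1 t\<^sub>1) (J\<^sub>1 t\<^sub>1) \<le> l t\<^sub>1 * (rnorm A g (\<gamma> t\<^sub>1) (J\<^sub>1 t\<^sub>1))\<^sup>2)) \<and>
     (\<kappa> = 1 \<longrightarrow>
       (\<forall>\<alpha>\<in>{0..<pi}. \<forall>t\<^sub>0\<in>{0..<pi - \<alpha>}.
          t\<^sub>0 + \<alpha> > 0 \<and> J\<^sub>0 t\<^sub>0 \<noteq> 0 \<and>
          rinner A g (\<gamma> t\<^sub>0) (S J\<^sub>0 t\<^sub>0) (J\<^sub>0 t\<^sub>0) \<le> cot (t\<^sub>0 + \<alpha>) * (rnorm A g (\<gamma> t\<^sub>0) (J\<^sub>0 t\<^sub>0))\<^sup>2 \<longrightarrow>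
          (\<exists>J\<in>\<Lambda> - {0}. \<exists>t\<^sub>2\<in>{t\<^sub>0<..pi - \<alpha>}. J t\<^sub>2 = 0)))"
proof -
  interpret lagrangian_family A g \<gamma> \<kappa> \<Lambda>
    using assms by unfold_locales (simp_all add: complete_riemannian_manifold_def)
  have S: "S J = D J" if "J \<in> \<Lambda>" for J
    using that by (simp add: assms(9) riccati_operator_def)
  note J0 = \<open>J\<^sub>0 \<in> \<Lambda>\<close>
  show ?thesis
  proof (intro conjI allI impI ballI)
    fix t0 tm t1 and l :: "real \<Rightarrow> real"
    assume H: "t0 < tm \<and> J\<^sub>0 t0 \<noteq> 0 \<and> (\<forall>t\<in>{t0<..<tm}. \<not> singularity \<Lambda> t) \<and>
        (\<forall>t\<in>{t0..<tm}. \<exists>l'. (l has_real_derivative l') (at t within {t0..<tm}) \<and> l' + (l t)\<^sup>2 + \<kappa> = 0) \<and>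
        rinner A g (\<gamma> t0) (S J\<^sub>0 t0) (J\<^sub>0 t0) \<le> l t0 * (rnorm A g (\<gamma> t0) (J\<^sub>0 t0))\<^sup>2"
      and t1: "t1 \<in> {t0..<tm}"
    have init: "inner_at t0 (D J\<^sub>0 t0) (J\<^sub>0 t0) \<le> l t0 * inner_at t0 (J\<^sub>0 t0) (J\<^sub>0 t0)"
      using H S[OF J0] by (simp add: rnorm_squared)
    have l: "(l has_real_derivative - (l t)\<^sup>2 - \<kappa>) (at t within {t0..t1})" if "t \<in> {t0..t1}" for t
    proof -
      have "t \<in> {t0..<tm}" using that t1 by auto
      then obtain l' where l': "(l has_real_derivative l') (at t within {t0..<tm})" "l' + (l t)\<^sup>2 + \<kappa> = 0"
        using H by blast
      then have "l' = - (l t)\<^sup>2 - \<kappa>" by simp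
      then show ?thesis using l'(1) t1 by (auto intro: DERIV_subset)
    qed
    have "\<exists>J\<in>\<Lambda> - {0}. inner_at t1 (D J t1) (J t1) \<le> l t1 * inner_at t1 (J t1) (J t1)"
    proof (cases "t1 = t0")
      case True
      then show ?thesis using init J0 \<open>J\<^sub>0 \<noteq> 0\<close> by blast
    next
      case False
      then show ?thesis
        using H t1 J0 l init by (intro comparison[of t0 t1 J\<^sub>0 l]) auto
    qed
    then show "\<exists>J\<^sub>1\<in>\<Lambda> - {0}. rinner A g (\<gamma> t1) (S J\<^sub>1 t1) (J\<^sub>1 t1) \<le> l t1 * (rnorm A g (\<gamma> t1) (J\<^sub>1 t1))\<^sup>2"
      by (auto simp: S rnorm_squared)
  next
    fix \<alpha> t0
    assume \<kappa>: "\<kappa> = 1" and \<alpha>: "\<alpha> \<in> {0..<pi}" and t0: "t0 \<in> {0..<pi - \<alpha>}"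
      and H: "t0 + \<alpha> > 0 \<and> J\<^sub>0 t0 \<noteq> 0 \<and>
          rinner A g (\<gamma> t0) (S J\<^sub>0 t0) (J\<^sub>0 t0) \<le> cot (t0 + \<alpha>) * (rnorm A g (\<gamma> t0) (J\<^sub>0 t0))\<^sup>2"
    have "\<exists>t\<in>{t0<..pi - \<alpha>}. singularity \<Lambda> t"
    proof (rule singularity_before_pole[of t0 "pi - \<alpha>" "J\<^sub>0" "\<lambda>t. cot (t + \<alpha>)"])
      fix t assume "t \<in> {t0..<pi - \<alpha>}"
      then have "sin (t + \<alpha>) > 0" using H by (intro sin_gt_zero) auto
      then show "((\<lambda>t. cot (t + \<alpha>)) has_real_derivative - (cot (t + \<alpha>))\<^sup>2 - \<kappa>) (at t)"
        using cot_riccati[of t \<alpha>] \<kappa> by simp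
    qed (use t0 H J0 S[OF J0] cot_pole in \<open>auto simp: rnorm_squared\<close>)
    then show "\<exists>J\<in>\<Lambda> - {0}. \<exists>t\<^sub>2\<in>{t0<..pi - \<alpha>}. J t\<^sub>2 = 0"
      by (auto simp: singularity_def)
  qed
qed

end
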